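(* For every real $t$ with $0<t<1/4$ there exists a smooth, strictly positive, centrally symmetric, strongly log-concave probability density $\rho$ on $\mathbb{R}^2$ such that no two perpendicular lines cut the measure $\rho(x)\,dx$ into four regions whose masses, in cyclic order, are $$t,\quad t,\quad \tfrac12-t,\quad \tfrac12-t .$$ Moreover, $\rho$ may be chosen arbitrarily close in $C^2(\mathbb{R}^2)$ to the standard Gaussian density: for every such $t$ and every $\delta>0$ there is such a $\rho$ with $\|\rho-g_0\|_{C^2(\mathbb{R}^2)}<\delta$, where $g_0(x,y)=\frac1{2\pi}e^{-(x^2+y^2)/2}$.
   Context: Two perpendicular lines divide the plane into four open quadrant-shaped regions (sectors), listed in cyclic order around the intersection point; the condition concerns any cyclic labelling of these regions. A density $\rho$ is centrally symmetric if $\rho(-x)=\rho(x)$ for all $x$. A smooth positive density $\rho$ is strongly log-concave if there is $c>0$ such that $\nabla^2(-\log\rho)(x)-cI$ is positive semidefinite for all $x\in\mathbb{R}^2$. The norm $\|\cdot\|_{C^2(\mathbb{R}^2)}$ is the maximum of the suprema over $\mathbb{R}^2$ of the absolute values of all partial derivatives of order at most $2$. *)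

theory Defs
  imports "HOL-Probability.Probability"
begin

definition partial_deriv :: "2 \<Rightarrow> (real^2 \<Rightarrow> real) \<Rightarrow> real^2 \<Rightarrow> real" where
  "partial_deriv i f x = deriv (\<lambda>s. f (x + s *\<^sub>R axis i 1)) 0"

fun C_k :: "nat \<Rightarrow> (real^2 \<Rightarrow> real) \<Rightarrow> bool" where
  "C_k 0 f \<longleftrightarrow> continuous_on UNIV f"
| "C_k (Suc k) f \<longleftrightarrow> (\<forall>x. f differentiable at x) \<and> (\<forall>i. C_k k (partial_deriv i f))"

definition smooth :: "(real^2 \<Rightarrow> real) \<Rightarrow> bool" where
  "smooth f \<longleftrightarrow> (\<forall>k. C_k k f)"

definition hessian :: "(real^2 \<Rightarrow> real) \<Rightarrow> real^2 \<Rightarrow> real^2^2" where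
  "hessian f x = (\<chi> i j. partial_deriv i (partial_deriv j f) x)"

text \<open>No symmetry is demanded here: the Hessian of a smooth function is symmetric anyway.\<close>

definition pos_semidef :: "real^2^2 \<Rightarrow> bool" where
  "pos_semidef A \<longleftrightarrow> (\<forall>v. 0 \<le> v \<bullet> (A *v v))"

definition strongly_log_concave :: "(real^2 \<Rightarrow> real) \<Rightarrow> bool" where
  "strongly_log_concave \<rho> \<longleftrightarrow>
     smooth \<rho> \<and> (\<forall>x. 0 < \<rho> x) \<and>
     (\<exists>c>0. \<forall>x. pos_semidef (hessian (\<lambda>y. - ln (\<rho> y)) x - mat c))"

definition centrally_symmetric :: "(real^2 \<Rightarrow> real) \<Rightarrow> bool" where
  "centrally_symmetric \<rho> \<longleftrightarrow> (\<forall>x. \<rho> (- x) = \<rho> x)"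

definition density_measure :: "(real^2 \<Rightarrow> real) \<Rightarrow> (real^2) measure" where
  "density_measure \<rho> = density lborel (\<lambda>x. ennreal (\<rho> x))"

text \<open>Nonnegativity is explicit because \<^const>\<open>ennreal\<close> truncates negative values to 0.\<close>

definition probability_density :: "(real^2 \<Rightarrow> real) \<Rightarrow> bool" where
  "probability_density \<rho> \<longleftrightarrow>
     \<rho> \<in> borel_measurable borel \<and> (\<forall>x. 0 \<le> \<rho> x) \<and> prob_space (density_measure \<rho>)"

text \<open>The values are extended reals, so that an unbounded derivative gives norm infinity;
  a real-valued supremum would be unspecified there.\<close>

definition sup_norm :: "(real^2 \<Rightarrow> real) \<Rightarrow> ereal" where
  "sup_norm f = (SUP x. ereal \<bar>f x\<bar>)"

definition C2_norm :: "(real^2 \<Rightarrow> real) \<Rightarrow> ereal" where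
  "C2_norm f = Max ({sup_norm f} \<union> {sup_norm (partial_deriv i f) | i. True}
                     \<union> {sup_norm (partial_deriv i (partial_deriv j f)) | i j. True})"

definition std_gaussian :: "real^2 \<Rightarrow> real" where
  "std_gaussian z = 1 / (2 * pi) * exp (- ((z$1)\<^sup>2 + (z$2)\<^sup>2) / 2)"

definition line_through :: "real^2 \<Rightarrow> real^2 \<Rightarrow> (real^2) set" where
  "line_through p u = {p + s *\<^sub>R u | s. True}"

definition open_sector :: "real^2 \<Rightarrow> real^2 \<Rightarrow> real^2 \<Rightarrow> (real^2) set" where
  "open_sector p u v = {p + a *\<^sub>R u + b *\<^sub>R v | a b. 0 < a \<and> 0 < b}"

text \<open>L and L' are perpendicular lines, and A, B, C, D are the four open regions they cut out,
  in cyclic order. Since u and v range over all orthogonal pairs of directions of the two lines,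
  in either order, all eight labellings (four starting regions, two orientations) are covered.\<close>

definition perpendicular_cut ::
  "(real^2) set \<Rightarrow> (real^2) set \<Rightarrow>
   (real^2) set \<Rightarrow> (real^2) set \<Rightarrow> (real^2) set \<Rightarrow> (real^2) set \<Rightarrow> bool" where
  "perpendicular_cut L L' A B C D \<longleftrightarrow>
     (\<exists>p u v. u \<noteq> 0 \<and> v \<noteq> 0 \<and> orthogonal u v \<and>
        {L, L'} = {line_through p u, line_through p v} \<and>
        A = open_sector p u v \<and> B = open_sector p v (- u) \<and>
        C = open_sector p (- u) (- v) \<and> D = open_sector p (- v) u)"

definition perpendicular_cut_masses ::
  "(real^2) measure \<Rightarrow> real \<Rightarrow> real \<Rightarrow> real \<Rightarrow> real \<Rightarrow> bool" where
  "perpendicular_cut_masses M a b c d \<longleftrightarrow>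
     (\<exists>L L' A B C D. perpendicular_cut L L' A B C D \<and>
        measure M A = a \<and> measure M B = b \<and> measure M C = c \<and> measure M D = d)"

definition uncuttable_density :: "real \<Rightarrow> (real^2 \<Rightarrow> real) \<Rightarrow> bool" where
  "uncuttable_density t \<rho> \<longleftrightarrow>
     smooth \<rho> \<and> (\<forall>x. 0 < \<rho> x) \<and> centrally_symmetric \<rho> \<and>
     strongly_log_concave \<rho> \<and> probability_density \<rho> \<and>
     \<not> perpendicular_cut_masses (density_measure \<rho>) t t (1/2 - t) (1/2 - t)"

end

theory Submission
  imports Defs
begin

text \<open>If a density is symmetric and a cut has masses \<open>t, t, 1/2 - t, 1/2 - t\<close>, one of the lines halves the mass
  and hence passes through the origin, while the other one cuts off a half-plane \<open>H\<close> of mass \<open>2t\<close>;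
  the first line must then halve \<open>H\<close>. Let \<open>D(\<theta>)\<close> be the difference of the masses of the two halves of \<open>H\<close>
  when \<open>\<theta>\<close> is the direction of \<open>H\<close>. It vanishes identically for the Gaussian, and the first-order effect
  on \<open>D\<close> of any perturbation has mean zero over \<open>\<theta>\<close>, so a sign can only come from second order.

  Let \<open>h0\<close> be the distance with Gaussian tail \<open>2t\<close>. The perturbation \<open>\<epsilon> (Wa Re z\<^sup>2 + Wb Im z\<^sup>2)\<close> with radial weights
  \<open>Wa, Wb\<close>, combinations of \<open>exp (- l |z|\<^sup>2)\<close> for \<open>l = 1, 4, 9\<close>, is chosen such that its
  contribution to \<open>D\<close> vanishes at \<open>h0\<close> and has \<open>h\<close>-derivative \<open>- 4 h0 cos 2\<theta>\<close> there. It moves the boundary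
  of \<open>H\<close> by \<open>\<epsilon> const cos 2\<theta>\<close>, so that \<open>D = - \<epsilon>\<^sup>2 K cos\<^sup>2 2\<theta> + o(\<epsilon>\<^sup>2)\<close> with \<open>K > 0\<close>. A term
  \<open>\<epsilon>\<^sup>2 const exp (- |z|\<^sup>2) Im z\<^sup>4\<close> adds \<open>\<epsilon>\<^sup>2 (K/2) cos 4\<theta>\<close>, which leaves \<open>D = - \<epsilon>\<^sup>2 K/2 + o(\<epsilon>\<^sup>2)\<close>, uniformly
  in \<open>\<theta>\<close>.\<close>

section \<open>Gaussian moments on half-lines\<close>

text \<open>Up to a constant factor the integrand is that of the \<open>j\<close>-th moment of the
  centred normal density of variance \<open>1 / (2 * l)\<close>.\<close>

lemma integrable_power_gauss:
  fixes l :: real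
  assumes "0 < l"
  shows "integrable lborel (\<lambda>y. y ^ j * exp (- (l * y\<^sup>2)))"
proof -
  define \<sigma> where "\<sigma> = 1 / sqrt (2 * l)"
  have \<sigma>: "0 < \<sigma>" and l: "2 * \<sigma>\<^sup>2 = 1 / l"
    using assms by (auto simp: \<sigma>_def power_divide)
  have "(\<lambda>y. y ^ j * exp (- (l * y\<^sup>2))) =
      (\<lambda>y. sqrt (2 * pi * \<sigma>\<^sup>2) * (normal_density 0 \<sigma> y * (y - 0) ^ j))"
    using \<sigma> l by (auto simp: normal_density_def fun_eq_iff field_simps)
  then show ?thesis
    using integrable_normal_moment[OF \<sigma>, of 0 j] by simp
qed

text \<open>One term of the exponential series gives
  \<open>\<bar>x\<bar> ^ j \<le> fact j * exp \<bar>x\<bar>\<close>, and completing the square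
  bounds the remaining exponent \<open>\<bar>x\<bar> - l * x^2\<close> by
  \<open>1 / (4 * l)\<close>.\<close>

lemma power_gauss_bounded:
  fixes l :: real
  assumes "0 < l"
  shows "\<exists>B. \<forall>x. \<bar>x ^ j * exp (- (l * x\<^sup>2))\<bar> \<le> B"
proof (intro exI allI)
  fix x :: real
  have "\<bar>x\<bar> ^ j / fact j \<le> exp \<bar>x\<bar>"
  proof -
    have "(\<Sum>n\<in>{j}. \<bar>x\<bar> ^ n /\<^sub>R fact n) \<le> (\<Sum>n. \<bar>x\<bar> ^ n /\<^sub>R fact n)"
      by (intro sum_le_suminf summable_exp_generic) auto
    then show ?thesis
      by (simp add: exp_def divide_inverse mult.commute)
  qed
  then have "\<bar>x\<bar> ^ j \<le> fact j * exp \<bar>x\<bar>"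
    by (simp add: field_simps)
  then have "\<bar>x ^ j * exp (- (l * x\<^sup>2))\<bar> \<le> fact j * exp \<bar>x\<bar> * exp (- (l * x\<^sup>2))"
    by (simp add: abs_mult power_abs)
  also have "\<dots> = fact j * exp (\<bar>x\<bar> - l * x\<^sup>2)"
    by (simp add: exp_diff exp_minus field_simps)
  also have "\<bar>x\<bar> - l * x\<^sup>2 \<le> 1 / (4 * l)"
  proof -
    have "0 \<le> (2 * l * \<bar>x\<bar> - 1)\<^sup>2"
      by simp
    also have "\<dots> = 4 * l * (l * x\<^sup>2 - \<bar>x\<bar>) + 1"
      by (simp add: power2_eq_square algebra_simps)
    finally show ?thesis
      using assms by (simp add: field_simps)
  qed
  finally show "\<bar>x ^ j * exp (- (l * x\<^sup>2))\<bar> \<le> fact j * exp (1 / (4 * l))"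
    by simp
qed

text \<open>The next higher power is bounded, so this one is O(1/x).\<close>

lemma power_gauss_tendsto_0:
  fixes l :: real
  assumes "0 < l"
  shows "((\<lambda>x. x ^ j * exp (- (l * x\<^sup>2))) \<longlongrightarrow> 0) at_top"
proof -
  obtain B where B: "\<And>x. \<bar>x ^ Suc j * exp (- (l * x\<^sup>2))\<bar> \<le> B"
    using power_gauss_bounded[OF assms] by blast
  show ?thesis
  proof (rule Lim_null_comparison)
    show "\<forall>\<^sub>F x in at_top. norm (x ^ j * exp (- (l * x\<^sup>2))) \<le> B / x"
      using eventually_gt_at_top[of 0]
    proof eventually_elim
      case (elim x)
      then show ?case
        using B[of x] by (simp add: pos_le_divide_eq abs_mult mult_ac)
    qed
    show "((\<lambda>x. B / x) \<longlongrightarrow> 0) at_top"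
      by (intro real_tendsto_divide_at_top[OF tendsto_const] filterlim_ident)
  qed
qed

definition tail_moment :: "nat \<Rightarrow> real \<Rightarrow> real \<Rightarrow> real" where
  "tail_moment j l h = (LBINT y:{h<..}. y ^ j * exp (- (l * y\<^sup>2)))"

lemma set_integrable_power_gauss:
  "0 < l \<Longrightarrow> A \<in> sets borel \<Longrightarrow> set_integrable lborel A (\<lambda>y. y ^ j * exp (- (l * y\<^sup>2)) :: real)"
  unfolding set_integrable_def by (intro integrable_mult_indicator integrable_power_gauss) auto

lemma tail_integral_FTC:
  fixes F f :: "real \<Rightarrow> real"
  assumes F: "\<And>x. (F has_real_derivative f x) (at x)"
    and f: "continuous_on UNIV f" "set_integrable lborel {h<..} f"
    and lim: "(F \<longlongrightarrow> 0) at_top"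
  shows "(LBINT y:{h<..}. f y) = - F h"
proof -
  have e: "einterval (ereal h) \<infinity> = {h<..}"
    by (auto simp: einterval_def)
  have "(LBINT y=ereal h..\<infinity>. f y) = 0 - F h"
  proof (rule interval_integral_FTC_integrable)
    show "((F \<circ> real_of_ereal) \<longlongrightarrow> F h) (at_right (ereal h))"
      unfolding ereal_tendsto_simps
      using DERIV_isCont[OF F[of h]] by (meson continuous_within filterlim_at_split)
    show "((F \<circ> real_of_ereal) \<longlongrightarrow> 0) (at_left \<infinity>)"
      unfolding ereal_tendsto_simps by (rule lim)
  qed (use F f e in \<open>auto simp: has_real_derivative_iff_has_vector_derivative
        continuous_on_eq_continuous_at\<close>)
  then show ?thesis
    by (simp add: interval_lebesgue_integral_def e)
qed

lemma tail_moment_1: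
  assumes "0 < l"
  shows "tail_moment 1 l h = exp (- (l * h\<^sup>2)) / (2 * l)"
proof -
  have "(LBINT y:{h<..}. y ^ 1 * exp (- (l * y\<^sup>2))) = - (- (exp (- (l * h\<^sup>2)) / (2 * l)))"
  proof (rule tail_integral_FTC)
    show "((\<lambda>y. - (exp (- (l * y\<^sup>2)) / (2 * l))) \<longlongrightarrow> 0) at_top"
      using tendsto_mult_right[OF power_gauss_tendsto_0[OF assms, of 0], of "- (1 / (2 * l))"] by simp
    show "set_integrable lborel {h<..} (\<lambda>y. y ^ 1 * exp (- (l * y\<^sup>2)))"
      by (rule set_integrable_power_gauss[OF assms]) auto
  qed (use assms in \<open>auto intro!: derivative_eq_intros continuous_intros\<close>)
  then show ?thesis
    by (simp add: tail_moment_def)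
qed

text \<open>Integration by parts: \<open>- y ^ Suc j * exp (- (l * y^2)) / (2 * l)\<close> is a
  primitive of the difference of the two integrands and vanishes at infinity. All even moments thus
  reduce to the zeroth one, which has no elementary form.\<close>

lemma tail_moment_Suc_Suc:
  assumes "0 < l"
  shows "tail_moment (Suc (Suc j)) l h =
    h ^ Suc j * exp (- (l * h\<^sup>2)) / (2 * l) + real (Suc j) / (2 * l) * tail_moment j l h"
proof -
  let ?f = "\<lambda>j y. y ^ j * exp (- (l * y\<^sup>2))"
  have i: "set_integrable lborel {h<..} (?f j)" for j
    by (rule set_integrable_power_gauss[OF assms]) auto
  have "(LBINT y:{h<..}. ?f (Suc (Suc j)) y - real (Suc j) / (2 * l) * ?f j y)
      = - (- (?f (Suc j) h / (2 * l)))"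
  proof (rule tail_integral_FTC)
    show "((\<lambda>y. - (?f (Suc j) y / (2 * l))) \<longlongrightarrow> 0) at_top"
      using tendsto_mult_right[OF power_gauss_tendsto_0[OF assms, of "Suc j"], of "- (1 / (2 * l))"]
      by simp
    show "((\<lambda>y. - (?f (Suc j) y / (2 * l))) has_real_derivative
        ?f (Suc (Suc j)) y - real (Suc j) / (2 * l) * ?f j y) (at y)" for y
    proof -
      have "((\<lambda>y. y ^ Suc j) has_real_derivative real (Suc j) * y ^ j) (at y)"
        using DERIV_pow[of "Suc j" y] by simp
      moreover have "((\<lambda>y. exp (- (l * y\<^sup>2))) has_real_derivative
          exp (- (l * y\<^sup>2)) * - (2 * l * y)) (at y)"
        by (auto intro!: derivative_eq_intros)
      ultimately show ?thesis
        by (rule DERIV_cong[OF DERIV_minus[OF DERIV_cdivide[OF DERIV_mult]]])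
          (use assms in \<open>simp add: field_simps\<close>)
    qed
    show "set_integrable lborel {h<..} (\<lambda>y. ?f (Suc (Suc j)) y - real (Suc j) / (2 * l) * ?f j y)"
      by (intro set_integral_diff set_integrable_mult_right i)
  qed (use assms in \<open>auto intro!: continuous_intros\<close>)
  also have "(LBINT y:{h<..}. ?f (Suc (Suc j)) y - real (Suc j) / (2 * l) * ?f j y)
      = tail_moment (Suc (Suc j)) l h - real (Suc j) / (2 * l) * tail_moment j l h"
    unfolding tail_moment_def
    by (subst set_integral_diff) (intro set_integrable_mult_right i | simp only: set_integral_mult_right)+
  finally show ?thesis
    by (simp add: algebra_simps)
qed

lemma tail_moment_0_at_0:
  assumes "0 < l"
  shows "tail_moment 0 l 0 = sqrt (pi / l) / 2"
proof -
  have "has_bochner_integral lborel (\<lambda>x. indicator {0..} x *\<^sub>R exp (- (l * x\<^sup>2))) ((sqrt pi / 2) /\<^sub>R sqrt l)"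
    using gaussian_moment_0 assms
    by (subst (asm) lborel_has_bochner_integral_real_affine_iff[where c="sqrt l" and t=0])
       (auto simp: indicator_def power_mult_distrib zero_le_mult_iff)
  then have "(LBINT x:{0..}. exp (- (l * x\<^sup>2))) = sqrt (pi / l) / 2"
    by (simp add: set_lebesgue_integral_def has_bochner_integral_integral_eq real_sqrt_divide field_simps)
  moreover have "(LBINT x:{0..}. exp (- (l * x\<^sup>2))) = (LBINT x:{0<..}. exp (- (l * x\<^sup>2)))"
    by (rule set_integral_cong_set) (auto simp: set_borel_measurable_def intro!: AE_I[where N="{0}"])
  ultimately show ?thesis
    by (simp add: tail_moment_def)
qed

lemma tail_moment_0_deriv:
  assumes "0 < l"
  shows "((\<lambda>h. tail_moment 0 l h) has_real_derivative - exp (- (l * h\<^sup>2))) (at h)"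
proof -
  let ?g = "\<lambda>x. exp (- (l * x\<^sup>2))"
  have i: "set_integrable lborel A ?g" if "A \<in> sets borel" for A
    using set_integrable_power_gauss[OF assms that, of 0] by simp
  \<comment> \<open>The base point \<open>h - 1\<close> lies strictly below \<open>h\<close>, so
    that the formula holds on a whole neighbourhood of \<open>h\<close>.\<close>
  have split: "tail_moment 0 l x = tail_moment 0 l (h - 1) - integral {h - 1..x} ?g"
    if "h - 1 \<le> x" for x
  proof -
    have "(LBINT y:{h - 1<..}. ?g y) = (LBINT y:{h - 1<..x} \<union> {x<..}. ?g y)"
      using that by (intro arg_cong2[where f="set_lebesgue_integral lborel"]) auto
    also have "\<dots> = (LBINT y:{h - 1<..x}. ?g y) + (LBINT y:{x<..}. ?g y)"
      by (rule set_integral_Un) (auto intro: i)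
    also have "(LBINT y:{h - 1<..x}. ?g y) = (LBINT y:{h - 1..x}. ?g y)"
      by (rule set_integral_cong_set)
        (auto simp: set_borel_measurable_def intro!: AE_I[where N="{h - 1}"])
    also have "\<dots> = integral {h - 1..x} ?g"
      by (intro set_borel_integral_eq_integral i) auto
    finally show ?thesis
      by (simp add: tail_moment_def)
  qed
  have "((\<lambda>x. integral {h - 1..x} ?g) has_real_derivative ?g h) (at h within {h - 1..h + 1})"
    by (intro integral_has_real_derivative continuous_intros) auto
  then have "((\<lambda>x. integral {h - 1..x} ?g) has_real_derivative ?g h) (at h)"
    by (simp add: at_within_Icc_at)
  then have "((\<lambda>x. tail_moment 0 l (h - 1) - integral {h - 1..x} ?g) has_real_derivative - ?g h) (at h)"
    by (auto intro!: derivative_eq_intros)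
  moreover have "\<forall>\<^sub>F x in nhds h. tail_moment 0 l x = tail_moment 0 l (h - 1) - integral {h - 1..x} ?g"
    by (rule eventually_nhds_in_open[of "{h - 1<..}", THEN eventually_mono]) (auto intro: split)
  ultimately show ?thesis
    by (subst DERIV_cong_ev) auto
qed

lemma tail_moment_0_tendsto:
  assumes "0 < l"
  shows "(tail_moment 0 l \<longlongrightarrow> 0) at_top"
proof -
  let ?g = "\<lambda>x. exp (- (l * x\<^sup>2)) :: real"
  have "((\<lambda>h. tail_moment 0 l h) \<longlongrightarrow> (LBINT x::real. 0)) at_top"
    unfolding tail_moment_def set_lebesgue_integral_def
  proof (rule integral_dominated_convergence_at_top)
    show "integrable lborel ?g"
      using integrable_power_gauss[OF assms, of 0] by simp
    show "AE x in lborel. ((\<lambda>h. indicat_real {h<..} x *\<^sub>R (x ^ 0 * ?g x)) \<longlongrightarrow> 0) at_top"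
    proof (rule AE_I2)
      fix x :: real
      have "\<forall>\<^sub>F h in at_top. indicat_real {h<..} x *\<^sub>R (x ^ 0 * ?g x) = 0"
        using eventually_gt_at_top[of x] by eventually_elim auto
      then show "((\<lambda>h. indicat_real {h<..} x *\<^sub>R (x ^ 0 * ?g x)) \<longlongrightarrow> 0) at_top"
        by (rule tendsto_eventually)
    qed
    show "\<forall>\<^sub>F h in at_top. AE x in lborel. norm (indicat_real {h<..} x *\<^sub>R (x ^ 0 * ?g x)) \<le> ?g x"
      by (auto intro!: always_eventually AE_I2 simp: indicator_def)
  qed auto
  then show ?thesis
    by simp
qed

section \<open>Integration over sectors of the plane\<close>

text \<open>It suffices to compare boxes. The preimage of a box is its image under the inverse map,
  which is again orthogonal and so preserves Lebesgue measure.\<close>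

lemma distr_lborel_orthogonal:
  fixes f :: "real^'n::{finite,wellorder} \<Rightarrow> real^'n::_"
  assumes f: "orthogonal_transformation f"
  shows "distr lborel borel f = lborel"
proof (rule lborel_eqI[symmetric])
  have lin: "linear f" "bij f"
    using f by (auto simp: orthogonal_transformation_linear orthogonal_transformation_bij)
  then have [measurable]: "f \<in> borel_measurable borel"
    by (intro borel_measurable_continuous_onI linear_continuous_on linear_conv_bounded_linear[THEN iffD1])
  show "sets (distr lborel borel f) = sets borel"
    by simp
  fix l u :: "real^'n::_"
  assume le: "\<And>b. b \<in> Basis \<Longrightarrow> l \<bullet> b \<le> u \<bullet> b"
  have eq: "f -` box l u = inv f ` box l u"
    using bij_vimage_eq_inv_image[OF lin(2)] .
  have m: "inv f ` box l u \<in> sets borel"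
    unfolding eq[symmetric] by (rule measurable_sets_borel[OF \<open>f \<in> borel_measurable borel\<close>]) simp
  have inv: "orthogonal_transformation (inv f)"
    by (rule orthogonal_transformation_inv[OF f])
  have fin: "inv f ` box l u \<in> lmeasurable"
    by (rule measurable_orthogonal_image[OF inv]) auto
  have "emeasure (distr lborel borel f) (box l u) = emeasure lborel (inv f ` box l u)"
    by (simp add: emeasure_distr eq)
  also have "\<dots> = emeasure lebesgue (inv f ` box l u)"
    using m by simp
  also have "\<dots> = measure lebesgue (box l u)"
    using fin measure_orthogonal_image[OF inv, of "box l u"] by (simp add: emeasure_eq_measure2)
  also have "\<dots> = emeasure lborel (box l u)"
    by (subst emeasure_eq_measure2[symmetric]) auto
  finally show "emeasure (distr lborel borel f) (box l u) = (\<Prod>b\<in>Basis. (u - l) \<bullet> b)"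
    using le by simp
qed

lemma Basis_real_2: "(Basis :: (real^2) set) = {axis 1 1, axis 2 1}"
  by (auto simp: Basis_vec_def UNIV_2)

lemma inner_real_2: "(x :: real^2) \<bullet> y = x $ 1 * y $ 1 + x $ 2 * y $ 2"
  by (simp add: inner_vec_def sum_2)

lemma real_2_eq_iff: "(x :: real^2) = y \<longleftrightarrow> x $ 1 = y $ 1 \<and> x $ 2 = y $ 2"
  by (simp add: vec_eq_iff forall_2)

lemma norm_real_2: "norm (x :: real^2) = sqrt ((x $ 1)\<^sup>2 + (x $ 2)\<^sup>2)"
  by (simp add: norm_eq_sqrt_inner inner_real_2 power2_eq_square)

text \<open>This identification carries Fubini's theorem from \<open>real \<times> real\<close> over
  to \<open>real^2\<close>.\<close>

lemma distr_lborel_coordinates: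
  "distr lborel borel (\<lambda>p :: real \<times> real. fst p *\<^sub>R axis 1 1 + snd p *\<^sub>R axis 2 1 :: real^2) = lborel"
proof (rule lborel_eqI[symmetric])
  have [measurable]: "(\<lambda>p :: real \<times> real. fst p *\<^sub>R axis 1 1 + snd p *\<^sub>R axis 2 1 :: real^2) \<in> borel_measurable borel"
    by (intro borel_measurable_continuous_onI continuous_intros)
  fix l u :: "real^2"
  assume le: "\<And>b. b \<in> Basis \<Longrightarrow> l \<bullet> b \<le> u \<bullet> b"
  have "(\<lambda>p :: real \<times> real. fst p *\<^sub>R axis 1 1 + snd p *\<^sub>R axis 2 1 :: real^2) -` box l u
      = {l $ 1<..<u $ 1} \<times> {l $ 2<..<u $ 2}"
    by (auto simp: mem_box_cart forall_2 axis_def)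
  then have "emeasure (distr lborel borel (\<lambda>p :: real \<times> real. fst p *\<^sub>R axis 1 1 + snd p *\<^sub>R axis 2 1 :: real^2)) (box l u)
      = emeasure lborel ({l $ 1<..<u $ 1} \<times> {l $ 2<..<u $ 2})"
    by (simp add: emeasure_distr)
  also have "\<dots> = (\<Prod>b\<in>Basis. (u - l) \<bullet> b)"
    using le[of "axis 1 1"] le[of "axis 2 1"] unfolding lborel_prod[symmetric]
    by (subst lborel.emeasure_pair_measure_Times)
      (auto simp: Basis_real_2 inner_axis axis_eq_axis ennreal_mult)
  finally show "emeasure (distr lborel borel (\<lambda>p. fst p *\<^sub>R axis 1 1 + snd p *\<^sub>R axis 2 1 :: real^2)) (box l u)
      = (\<Prod>b\<in>Basis. (u - l) \<bullet> b)" .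
qed simp

lemma distr_lborel_orthonormal:
  fixes u v :: "real^2"
  assumes "norm u = 1" "norm v = 1" "orthogonal u v"
  shows "distr lborel borel (\<lambda>p. fst p *\<^sub>R u + snd p *\<^sub>R v) = lborel"
proof -
  let ?f = "\<lambda>z :: real^2. z $ 1 *\<^sub>R u + z $ 2 *\<^sub>R v"
  have "orthogonal_transformation ?f"
    unfolding orthogonal_transformation_def
  proof (intro conjI allI)
    show "linear ?f"
      by (rule linearI) (auto simp: algebra_simps)
    have "u \<bullet> u = 1" "v \<bullet> v = 1" "u \<bullet> v = 0" "v \<bullet> u = 0"
      using assms by (auto simp: norm_eq_1 orthogonal_def inner_commute)
    then show "?f x \<bullet> ?f y = x \<bullet> y" for x y
      by (simp add: inner_add_left inner_add_right) (simp add: inner_real_2)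
  qed
  then have "distr lborel borel ?f = lborel"
    by (rule distr_lborel_orthogonal)
  then have "lborel = distr (distr lborel borel (\<lambda>p. fst p *\<^sub>R axis 1 1 + snd p *\<^sub>R axis 2 1 :: real^2)) borel ?f"
    by (simp add: distr_lborel_coordinates)
  also have "\<dots> = distr lborel borel (?f \<circ> (\<lambda>p. fst p *\<^sub>R axis 1 1 + snd p *\<^sub>R axis 2 1 :: real^2))"
  proof (rule distr_distr)
    show "?f \<in> borel_measurable borel"
      by (intro borel_measurable_continuous_onI continuous_intros)
    show "(\<lambda>p. fst p *\<^sub>R axis 1 1 + snd p *\<^sub>R axis 2 1 :: real^2) \<in> borel_measurable lborel"
      by (simp, intro borel_measurable_continuous_onI continuous_intros)
  qed
  finally show ?thesis
    by (simp add: o_def axis_def)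
qed

text \<open>In the orthonormal coordinates \<open>(u, v)\<close> the sector is a product of two
  half-lines, and the change of coordinates preserves Lebesgue measure.\<close>

lemma measure_density_sector:
  fixes u v :: "real^2" and f :: "real^2 \<Rightarrow> real"
  assumes uv: "norm u = 1" "norm v = 1" "orthogonal u v"
    and f: "f \<in> borel_measurable borel" "\<And>z. 0 \<le> f z"
    and int: "set_integrable lborel ({a<..} \<times> {b<..}) (\<lambda>p. f (fst p *\<^sub>R u + snd p *\<^sub>R v))"
  shows "measure (density_measure f) {z. a < z \<bullet> u \<and> b < z \<bullet> v} =
    (LINT p:{a<..} \<times> {b<..}|lborel. f (fst p *\<^sub>R u + snd p *\<^sub>R v))"
proof -
  let ?g = "\<lambda>p. fst p *\<^sub>R u + snd p *\<^sub>R v"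
  let ?A = "{z. a < z \<bullet> u \<and> b < z \<bullet> v}"
  note [measurable] = f(1)
  have [measurable]: "?g \<in> borel_measurable borel"
    by (intro borel_measurable_continuous_onI continuous_intros)
  have [measurable]: "?A \<in> sets borel"
    by measurable
  have "u \<bullet> u = 1" "v \<bullet> v = 1" "u \<bullet> v = 0" "v \<bullet> u = 0"
    using uv by (auto simp: norm_eq_1 orthogonal_def inner_commute)
  then have A: "?g p \<in> ?A \<longleftrightarrow> p \<in> {a<..} \<times> {b<..}" for p
    by (cases p) (simp add: inner_add_left)
  have "emeasure (density_measure f) ?A = (\<integral>\<^sup>+z. ennreal (f z) * indicator ?A z \<partial>lborel)"
    unfolding density_measure_def by (rule emeasure_density) auto
  also have "\<dots> = (\<integral>\<^sup>+z. ennreal (f z) * indicator ?A z \<partial>distr lborel borel ?g)"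
    by (simp add: distr_lborel_orthonormal[OF uv])
  also have "\<dots> = (\<integral>\<^sup>+p. ennreal (f (?g p)) * indicator ?A (?g p) \<partial>lborel)"
    by (rule nn_integral_distr) auto
  also have "\<dots> = (\<integral>\<^sup>+p. ennreal (f (?g p)) * indicator ({a<..} \<times> {b<..}) p \<partial>lborel)"
    using A by (simp add: indicator_def)
  also have "\<dots> = ennreal (LINT p:{a<..} \<times> {b<..}|lborel. f (?g p))"
    using f(2) int unfolding set_integrable_def set_lebesgue_integral_def
    by (subst nn_integral_eq_integral[symmetric])
      (auto intro!: nn_integral_cong simp: indicator_def)
  finally show ?thesis
    using f(2) by (simp add: measure_def set_lebesgue_integral_def Bochner_Integration.integral_nonneg)
qed

text \<open>The radial exponential factorises, so Fubini turns the plane integral into a product of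
  one-dimensional moments.\<close>

lemma power_gauss_product:
  fixes l :: real
  assumes "0 < l" "A \<in> sets borel" "B \<in> sets borel"
  shows "set_integrable lborel (A \<times> B)
      (\<lambda>p. fst p ^ i * snd p ^ j * exp (- (l * ((fst p)\<^sup>2 + (snd p)\<^sup>2))))" (is ?int)
    and "(LINT p:A \<times> B|lborel. fst p ^ i * snd p ^ j * exp (- (l * ((fst p)\<^sup>2 + (snd p)\<^sup>2))))
      = (LINT x:A|lborel. x ^ i * exp (- (l * x\<^sup>2))) * (LINT y:B|lborel. y ^ j * exp (- (l * y\<^sup>2)))"
      (is ?eq)
proof -
  let ?f = "\<lambda>x. indicat_real A x * (x ^ i * exp (- (l * x\<^sup>2)))"
  let ?g = "\<lambda>y. indicat_real B y * (y ^ j * exp (- (l * y\<^sup>2)))"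
  note [measurable] = assms(2,3)
  have f: "integrable lborel ?f" and g: "integrable lborel ?g"
    using set_integrable_power_gauss[OF assms(1)] assms(2,3)
    by (auto simp: set_integrable_def)
  have eq: "(\<lambda>p. indicat_real (A \<times> B) p *\<^sub>R
      (fst p ^ i * snd p ^ j * exp (- (l * ((fst p)\<^sup>2 + (snd p)\<^sup>2))))) = (\<lambda>(x, y). ?f x * ?g y)"
    by (auto simp: fun_eq_iff indicator_def distrib_left exp_add[symmetric])
  have int: "integrable (lborel \<Otimes>\<^sub>M lborel) (\<lambda>(x, y). ?f x * ?g y)"
  proof (rule lborel_pair.Fubini_integrable)
    show "integrable lborel (\<lambda>x. LINT y|lborel. norm (case (x, y) of (x, y) \<Rightarrow> ?f x * ?g y))"
      using integrable_norm[OF f] by (auto simp: abs_mult)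
    show "AE x in lborel. integrable lborel (\<lambda>y. case (x, y) of (x, y) \<Rightarrow> ?f x * ?g y)"
      using g by auto
  qed measurable
  then show ?int
    unfolding set_integrable_def eq lborel_prod .
  have "integral\<^sup>L (lborel \<Otimes>\<^sub>M lborel) (\<lambda>(x, y). ?f x * ?g y) = (LINT x|lborel. LINT y|lborel. ?f x * ?g y)"
    using lborel_pair.integral_fst'[OF int] by simp
  then show ?eq
    unfolding set_lebesgue_integral_def eq lborel_prod by simp
qed

section \<open>Equipartition forces the cut through the origin\<close>

definition perp :: "real^2 \<Rightarrow> real^2" where
  "perp u = vector [- u $ 2, u $ 1]"

lemma perp_nth [simp]: "perp u $ 1 = - u $ 2" "perp u $ 2 = u $ 1"
  by (simp_all add: perp_def)

lemma perp_minus: "perp (- u) = - perp u"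
  by (simp add: real_2_eq_iff)

lemma norm_perp [simp]: "norm (perp u) = norm u"
  by (simp add: norm_real_2 add.commute)

lemma orthogonal_perp: "orthogonal u (perp u)"
  by (simp add: orthogonal_def inner_real_2)

lemma orthogonal_eq_scaleR_perp:
  assumes "u \<noteq> 0" "orthogonal u v"
  shows "\<exists>k. v = k *\<^sub>R perp u"
proof
  have "(u $ 1)\<^sup>2 + (u $ 2)\<^sup>2 \<noteq> 0"
    using assms(1) by (simp add: real_2_eq_iff sum_power2_eq_zero_iff)
  moreover have "u $ 1 * v $ 1 = - (u $ 2 * v $ 2)"
    using assms(2) by (simp add: orthogonal_def inner_real_2)
  ultimately show "v = ((v \<bullet> perp u) / ((u $ 1)\<^sup>2 + (u $ 2)\<^sup>2)) *\<^sub>R perp u"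
    apply (simp add: real_2_eq_iff inner_real_2 field_simps power2_eq_square)
    by algebra
qed

lemma open_sector_eq:
  assumes "u \<noteq> 0" "v \<noteq> 0" "orthogonal u v"
  shows "open_sector p u v = {z. p \<bullet> u < z \<bullet> u \<and> p \<bullet> v < z \<bullet> v}"
proof (intro set_eqI iffI)
  have uv: "u \<bullet> v = 0" "v \<bullet> u = 0" "0 < u \<bullet> u" "0 < v \<bullet> v"
    using assms by (auto simp: orthogonal_def inner_commute)
  fix z
  {
    assume "z \<in> open_sector p u v"
    then obtain a b where "z = p + a *\<^sub>R u + b *\<^sub>R v" "0 < a" "0 < b"
      by (auto simp: open_sector_def)
    then show "z \<in> {z. p \<bullet> u < z \<bullet> u \<and> p \<bullet> v < z \<bullet> v}"
      using uv by (simp add: inner_add_left)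
  next
    assume z: "z \<in> {z. p \<bullet> u < z \<bullet> u \<and> p \<bullet> v < z \<bullet> v}"
    define a where "a = (z - p) \<bullet> u / (u \<bullet> u)"
    define b where "b = (z - p) \<bullet> v / (v \<bullet> v)"
    obtain k where k: "v = k *\<^sub>R perp u"
      using orthogonal_eq_scaleR_perp assms by blast
    then have "k \<noteq> 0"
      using assms by auto
    have n: "u $ 1 * u $ 1 + u $ 2 * u $ 2 \<noteq> 0"
      using uv(3) unfolding inner_real_2 by linarith
    define x y where "x = z $ 1 - p $ 1" and "y = z $ 2 - p $ 2"
    have vv: "v \<bullet> v = k\<^sup>2 * (u $ 1 * u $ 1 + u $ 2 * u $ 2)"
      by (simp add: k inner_real_2 power2_eq_square algebra_simps)
    have b: "b * k = (- x * u $ 2 + y * u $ 1) / (u $ 1 * u $ 1 + u $ 2 * u $ 2)"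
    proof -
      have "(z - p) \<bullet> v = k * (- x * u $ 2 + y * u $ 1)"
        by (simp add: k inner_real_2 x_def y_def algebra_simps)
      moreover have "k * w / (k\<^sup>2 * N) * k = w / N" for w N :: real
        using \<open>k \<noteq> 0\<close> by (simp add: power2_eq_square)
      ultimately show ?thesis
        by (simp only: b_def vv)
    qed
    have a: "a = (x * u $ 1 + y * u $ 2) / (u $ 1 * u $ 1 + u $ 2 * u $ 2)"
      by (simp add: a_def inner_real_2 x_def y_def)
    have "z = p + a *\<^sub>R u + (b * k) *\<^sub>R perp u"
    proof -
      have "x = a * u $ 1 - (b * k) * u $ 2" "y = a * u $ 2 + (b * k) * u $ 1"
      proof -
        \<comment> \<open>Multiplying by the squared length \<open>N\<close> of \<open>u\<close>
          clears the denominators and leaves polynomial identities.\<close>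
        define N where "N = u $ 1 * u $ 1 + u $ 2 * u $ 2"
        have "N \<noteq> 0" "a * N = x * u $ 1 + y * u $ 2" "(b * k) * N = - x * u $ 2 + y * u $ 1"
          using n unfolding a b N_def by simp_all
        then have "N * x = N * (a * u $ 1 - (b * k) * u $ 2)" "N * y = N * (a * u $ 2 + (b * k) * u $ 1)"
          unfolding N_def by algebra+
        then show "x = a * u $ 1 - (b * k) * u $ 2" "y = a * u $ 2 + (b * k) * u $ 1"
          using \<open>N \<noteq> 0\<close> by simp_all
      qed
      then show ?thesis
        by (simp add: real_2_eq_iff x_def y_def)
    qed
    then have "z = p + a *\<^sub>R u + b *\<^sub>R v"
      by (simp add: k)
    moreover have "0 < a" "0 < b"
      using z uv by (simp_all add: a_def b_def inner_diff_left)
    ultimately show "z \<in> open_sector p u v"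
      unfolding open_sector_def by blast
  }
qed

locale symmetric_density =
  fixes \<rho> :: "real^2 \<Rightarrow> real"
  assumes cont: "continuous_on UNIV \<rho>"
    and pos: "0 < \<rho> x"
    and symm: "\<rho> (- x) = \<rho> x"
    and prob: "prob_space (density_measure \<rho>)"
begin

sublocale prob_space "density_measure \<rho>"
  by (rule prob)

lemma measurable_\<rho> [measurable]: "\<rho> \<in> borel_measurable borel"
  by (rule borel_measurable_continuous_onI[OF cont])

lemma sets_density_measure [simp, measurable_cong]: "sets (density_measure \<rho>) = sets borel"
  by (simp add: density_measure_def)

lemma space_density_measure [simp]: "space (density_measure \<rho>) = UNIV"
  by (simp add: density_measure_def)

text \<open>As \<open>\<rho>\<close> is positive everywhere, lines get mass zero and nonempty open
  sets get positive mass, just as for Lebesgue measure.\<close>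

lemma null_sets_density_measure: "N \<in> null_sets (density_measure \<rho>) \<longleftrightarrow> N \<in> null_sets lborel"
proof -
  have "N \<in> null_sets (density_measure \<rho>) \<longleftrightarrow> N \<in> sets lborel \<and> (AE x in lborel. x \<in> N \<longrightarrow> ennreal (\<rho> x) = 0)"
    unfolding density_measure_def by (rule null_sets_density_iff) simp
  also have "\<dots> \<longleftrightarrow> N \<in> sets lborel \<and> (AE x in lborel. x \<notin> N)"
    using pos by (simp add: ennreal_eq_0_iff flip: not_less)
  also have "\<dots> \<longleftrightarrow> N \<in> null_sets lborel"
    using AE_iff_null_sets[of N lborel] by (auto simp: null_sets_def)
  finally show ?thesis .
qed

lemma prob_open_pos:
  assumes "open S" "S \<noteq> {}"
  shows "0 < prob S"
proof -
  have "S \<notin> null_sets lborel"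
    using open_not_negligible[OF assms] by (auto simp: negligible_iff_null_sets null_sets_completionI)
  then have "S \<notin> null_sets (density_measure \<rho>)"
    by (simp add: null_sets_density_measure)
  then show ?thesis
    using assms(1) by (auto simp: null_sets_def emeasure_eq_measure zero_less_measure_iff)
qed

lemma prob_uminus:
  assumes [measurable]: "S \<in> sets borel"
  shows "prob {z. - z \<in> S} = prob S"
proof -
  have [measurable]: "{z. - z \<in> S} \<in> sets borel"
    using assms by measurable
  have "emeasure (density_measure \<rho>) S = (\<integral>\<^sup>+z. ennreal (\<rho> z) * indicator S z \<partial>lborel)"
    unfolding density_measure_def by (rule emeasure_density) auto
  also have "\<dots> = (\<integral>\<^sup>+z. ennreal (\<rho> z) * indicator S z \<partial>distr lborel borel uminus)"
    by (subst distr_lborel_orthogonal) (auto simp: orthogonal_transformation_def linear_uminus)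
  also have "\<dots> = (\<integral>\<^sup>+z. ennreal (\<rho> (- z)) * indicator S (- z) \<partial>lborel)"
    by (rule nn_integral_distr) auto
  also have "\<dots> = (\<integral>\<^sup>+z. ennreal (\<rho> z) * indicator {z. - z \<in> S} z \<partial>lborel)"
    by (simp add: symm indicator_def)
  also have "\<dots> = emeasure (density_measure \<rho>) {z. - z \<in> S}"
    unfolding density_measure_def by (rule emeasure_density[symmetric]) auto
  finally show ?thesis
    by (simp add: measure_def)
qed

text \<open>If \<open>c\<close> were positive, the half-plane, its reflection in the origin and the
  open strip between them would be disjoint, with total mass 1/2 + 1/2 plus the positive mass of the
  strip.\<close>

lemma halfplane_half_le:
  assumes "w \<noteq> 0" "prob {z. c < z \<bullet> w} = 1/2"
  shows "c \<le> 0"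
proof (rule ccontr)
  assume c: "\<not> c \<le> 0"
  let ?P = "{z. c < z \<bullet> w}" and ?N = "{z. - z \<in> {z. c < z \<bullet> w}}" and ?S = "{z. \<bar>z \<bullet> w\<bar> < c}"
  have o: "open ?S"
    by (intro open_Collect_less continuous_intros)
  have [measurable]: "?P \<in> sets borel" "?N \<in> sets borel" "?S \<in> sets borel"
    by measurable
  have "prob (?P \<union> ?N \<union> ?S) = prob (?P \<union> ?N) + prob ?S"
    using c by (intro finite_measure_Union) auto
  also have "prob (?P \<union> ?N) = prob ?P + prob ?N"
    using c by (intro finite_measure_Union) auto
  also have "prob ?N = 1/2"
    using prob_uminus[of ?P] assms(2) by simp
  finally have "prob (?P \<union> ?N \<union> ?S) = 1 + prob ?S"
    using assms(2) by simp
  moreover have "0 < prob ?S"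
    using c by (intro prob_open_pos o) (auto intro!: exI[of _ 0])
  moreover have "prob (?P \<union> ?N \<union> ?S) \<le> 1"
    by simp
  ultimately show False
    by simp
qed

lemma prob_halfplane_split:
  assumes "v \<noteq> 0"
  shows "prob {z. c < z \<bullet> w} = prob {z. c < z \<bullet> w \<and> d < z \<bullet> v} + prob {z. c < z \<bullet> w \<and> z \<bullet> v < d}"
proof -
  have "negligible {z. v \<bullet> z = d}"
    using assms by (intro negligible_hyperplane) auto
  then have n: "{z. z \<bullet> v = d} \<in> null_sets (density_measure \<rho>)"
    unfolding null_sets_density_measure
    by (simp add: negligible_iff_null_sets inner_commute null_sets_completion_iff)
  have [measurable]: "{z. c < z \<bullet> w} \<in> sets borel" "{z. c < z \<bullet> w \<and> d < z \<bullet> v} \<in> sets borel"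
    "{z. c < z \<bullet> w \<and> z \<bullet> v < d} \<in> sets borel"
    by measurable
  have "prob {z. c < z \<bullet> w} = prob ({z. c < z \<bullet> w \<and> d < z \<bullet> v} \<union> {z. c < z \<bullet> w \<and> z \<bullet> v < d})"
    by (rule finite_measure_eq_AE) (use AE_not_in[OF n] in \<open>auto elim: eventually_mono\<close>)
  also have "\<dots> = prob {z. c < z \<bullet> w \<and> d < z \<bullet> v} + prob {z. c < z \<bullet> w \<and> z \<bullet> v < d}"
    by (intro finite_measure_Union) auto
  finally show ?thesis .
qed

lemma cut_through_origin:
  assumes "perpendicular_cut_masses (density_measure \<rho>) t t (1/2 - t) (1/2 - t)"
  shows "\<exists>u h. norm u = 1 \<and> prob {z. 0 < z \<bullet> u \<and> h < z \<bullet> perp u} = t \<and>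
    prob {z. 0 < z \<bullet> (- u) \<and> h < z \<bullet> perp u} = t"
proof -
  obtain p u v where uv: "u \<noteq> 0" "v \<noteq> 0" "orthogonal u v"
    and A: "prob (open_sector p u v) = t" and B: "prob (open_sector p v (- u)) = t"
    and C: "prob (open_sector p (- u) (- v)) = 1/2 - t" and D: "prob (open_sector p (- v) u) = 1/2 - t"
    using assms unfolding perpendicular_cut_masses_def perpendicular_cut_def by blast
  note orth = uv(3) orthogonal_commute[THEN iffD1, OF uv(3)]
  let ?d = "p \<bullet> u" and ?h = "p \<bullet> v"
  have A: "prob {z. ?d < z \<bullet> u \<and> ?h < z \<bullet> v} = t"
    using A uv by (simp add: open_sector_eq)
  have B: "prob {z. - ?d < z \<bullet> (- u) \<and> ?h < z \<bullet> v} = t"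
    using B uv orth by (simp add: open_sector_eq orthogonal_clauses conj_commute)
  have C: "prob {z. - ?d < z \<bullet> (- u) \<and> z \<bullet> v < ?h} = 1/2 - t"
    using C uv orth by (simp add: open_sector_eq orthogonal_clauses)
  have D: "prob {z. ?d < z \<bullet> u \<and> z \<bullet> v < ?h} = 1/2 - t"
    using D uv orth by (simp add: open_sector_eq orthogonal_clauses conj_commute)
  \<comment> \<open>Sectors \<open>A\<close> and \<open>D\<close> fill the half-plane on the side of
    \<open>u\<close>, sectors \<open>B\<close> and \<open>C\<close> the opposite one. Both have mass
    \<open>t + (1/2 - t) = 1/2\<close>, and the two inequalities put the line in direction
    \<open>v\<close> through the origin.\<close>
  have "?d \<le> 0"
    by (rule halfplane_half_le[OF uv(1)]) (use prob_halfplane_split[OF uv(2), of ?d u ?h] A D in simp)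
  moreover have "- ?d \<le> 0"
    by (rule halfplane_half_le[of "- u"]) (use uv prob_halfplane_split[OF uv(2), of "- ?d" "- u" ?h] B C in simp_all)
  ultimately have d: "?d = 0"
    by simp
  define a where "a = u /\<^sub>R norm u"
  define h where "h = ?h / norm v"
  have a: "norm a = 1" "\<And>z. 0 < z \<bullet> u \<longleftrightarrow> 0 < z \<bullet> a" "\<And>z. z \<bullet> u < 0 \<longleftrightarrow> 0 < z \<bullet> (- a)"
    using uv by (auto simp: a_def zero_less_mult_iff mult_less_0_iff)
  obtain k where k: "v = k *\<^sub>R perp u"
    using orthogonal_eq_scaleR_perp uv by blast
  then have "k \<noteq> 0"
    using uv by auto
  define b where "b = v /\<^sub>R norm v"
  have b: "?h < z \<bullet> v \<longleftrightarrow> h < z \<bullet> b" for z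
    using uv by (simp add: h_def b_def field_simps)
  have ab: "prob {z. 0 < z \<bullet> a \<and> h < z \<bullet> b} = t" "prob {z. 0 < z \<bullet> (- a) \<and> h < z \<bullet> b} = t"
  proof -
    have "{z. ?d < z \<bullet> u \<and> ?h < z \<bullet> v} = {z. 0 < z \<bullet> a \<and> h < z \<bullet> b}"
      "{z. - ?d < z \<bullet> (- u) \<and> ?h < z \<bullet> v} = {z. 0 < z \<bullet> (- a) \<and> h < z \<bullet> b}"
      using a d b by auto
    then show "prob {z. 0 < z \<bullet> a \<and> h < z \<bullet> b} = t" "prob {z. 0 < z \<bullet> (- a) \<and> h < z \<bullet> b} = t"
      using A B by simp_all
  qed
  have pa: "perp a = perp u /\<^sub>R norm u"
    by (simp add: a_def real_2_eq_iff)
  show ?thesis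
  proof (cases "0 < k")
    case True
    then have "b = perp a"
      using uv unfolding pa b_def k by simp
    then show ?thesis
      using ab a(1) by blast
  next
    \<comment> \<open>With the other orientation, \<open>- u\<close> replaces \<open>u\<close>. This
      merely exchanges the two sectors of mass \<open>t\<close>.\<close>
    case False
    then have "b = perp (- a)"
      using uv \<open>k \<noteq> 0\<close> unfolding perp_minus pa b_def k by (simp add: abs_if)
    then show ?thesis
      using ab a(1) by (intro exI[of _ "- a"] exI[of _ h]) simp
  qed
qed

end

section \<open>Polynomials times Gaussians\<close>

definition gauss :: "real \<Rightarrow> real^2 \<Rightarrow> real" where
  "gauss l z = exp (- (l * ((z $ 1)\<^sup>2 + (z $ 2)\<^sup>2)))"

lemma gauss_mult: "gauss k z * gauss l z = gauss (k + l) z"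
  by (simp add: gauss_def exp_add[symmetric] algebra_simps)

text \<open>Sums may mix different rates \<open>l\<close>. The class is closed under partial
  derivatives and consists of bounded functions, so that smoothness and \<open>C^2\<close> bounds
  hold for every member.\<close>

inductive gauss_poly :: "(real^2 \<Rightarrow> real) \<Rightarrow> bool" where
  monomial: "0 < l \<Longrightarrow> gauss_poly (\<lambda>z. z $ 1 ^ i * z $ 2 ^ j * gauss l z)"
| add: "gauss_poly f \<Longrightarrow> gauss_poly g \<Longrightarrow> gauss_poly (\<lambda>z. f z + g z)"
| mult: "gauss_poly f \<Longrightarrow> gauss_poly (\<lambda>z. c * f z)"

lemma gauss_poly_diff: "gauss_poly f \<Longrightarrow> gauss_poly g \<Longrightarrow> gauss_poly (\<lambda>z. f z - g z)"
  using gauss_poly.add[OF _ gauss_poly.mult[of g "-1"], of f] by simp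

lemma gauss_poly_gauss: "0 < l \<Longrightarrow> gauss_poly (gauss l)"
  using gauss_poly.monomial[of l 0 0] by (simp add: eta_contract_eq)

lemma two_cases:
  fixes k :: 2
  obtains "k = 1" | "k = 2"
  using exhaust_2 by blast

text \<open>The relational form records that the derivative exists, whereas \<open>deriv\<close> has
  an unspecified value when it does not.\<close>

definition has_partial :: "2 \<Rightarrow> (real^2 \<Rightarrow> real) \<Rightarrow> real^2 \<Rightarrow> real \<Rightarrow> bool" where
  "has_partial k f x D \<longleftrightarrow> ((\<lambda>s. f (x + s *\<^sub>R axis k 1)) has_real_derivative D) (at 0)"

lemma has_partial_imp_partial_deriv: "has_partial k f x D \<Longrightarrow> partial_deriv k f x = D"
  unfolding has_partial_def partial_deriv_def by (rule DERIV_imp_deriv)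

lemma gauss_has_partial: "has_partial k (gauss l) x (- 2 * l * x $ k * gauss l x)"
  unfolding has_partial_def gauss_def
  by (cases k rule: two_cases) (auto simp: axis_def intro!: derivative_eq_intros)

lemma gauss_poly_has_partial:
  assumes "gauss_poly f"
  shows "\<exists>g. gauss_poly g \<and> (\<forall>x. has_partial k f x (g x))"
  using assms
proof induction
  case (monomial l i j)
  let ?m = "\<lambda>i j z. z $ 1 ^ i * z $ 2 ^ j * gauss l z"
  \<comment> \<open>For \<open>i = 0\<close> the truncated exponent \<open>i - 1\<close> is harmless
    because the coefficient \<open>real i\<close> vanishes; likewise for \<open>j\<close> in
    \<open>?g2\<close>.\<close>
  let ?g1 = "\<lambda>z. real i * ?m (i - 1) j z + (- 2 * l) * ?m (Suc i) j z"
  let ?g2 = "\<lambda>z. real j * ?m i (j - 1) z + (- 2 * l) * ?m i (Suc j) z"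
  have g: "gauss_poly ?g1" "gauss_poly ?g2"
    by (rule gauss_poly.add gauss_poly.mult gauss_poly.monomial monomial)+
  have "has_partial 1 (?m i j) x (?g1 x)" for x
    using gauss_has_partial[of 1 l x] unfolding has_partial_def
    by (auto simp: axis_def algebra_simps intro!: derivative_eq_intros)
  moreover have "has_partial 2 (?m i j) x (?g2 x)" for x
    using gauss_has_partial[of 2 l x] unfolding has_partial_def
    by (auto simp: axis_def algebra_simps intro!: derivative_eq_intros)
  ultimately show ?case
    using g by (cases k rule: two_cases) blast+
next
  case (add f g)
  then obtain f' g' where f': "gauss_poly f'" "\<And>x. has_partial k f x (f' x)"
    and g': "gauss_poly g'" "\<And>x. has_partial k g x (g' x)"
    by blast
  have "has_partial k (\<lambda>z. f z + g z) x (f' x + g' x)" for x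
    using f'(2)[of x] g'(2)[of x] unfolding has_partial_def by (rule DERIV_add)
  then show ?case
    using gauss_poly.add[OF f'(1) g'(1)] by blast
next
  case (mult f c)
  then obtain f' where f': "gauss_poly f'" "\<And>x. has_partial k f x (f' x)"
    by blast
  have "has_partial k (\<lambda>z. c * f z) x (c * f' x)" for x
    using f'(2)[of x] unfolding has_partial_def by (rule DERIV_cmult)
  then show ?case
    using gauss_poly.mult[OF f'(1)] by blast
qed

lemma gauss_poly_partial_deriv:
  assumes "gauss_poly f"
  shows "gauss_poly (partial_deriv k f)" "has_partial k f x (partial_deriv k f x)"
proof -
  obtain g where g: "gauss_poly g" "\<And>x. has_partial k f x (g x)"
    using gauss_poly_has_partial[OF assms] by blast
  then have "partial_deriv k f = g"
    using has_partial_imp_partial_deriv by blast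
  then show "gauss_poly (partial_deriv k f)" "has_partial k f x (partial_deriv k f x)"
    using g by simp_all
qed

lemma gauss_poly_differentiable:
  assumes "gauss_poly f"
  shows "f differentiable (at x)"
  using assms
proof induction
  case (monomial l i j)
  have n: "((\<lambda>z. z $ k) has_derivative (\<lambda>h. h $ k)) (at x)" for k :: 2 and x :: "real^2"
    by (rule bounded_linear_imp_has_derivative[OF bounded_linear_vec_nth])
  show ?case
    unfolding differentiable_def gauss_def
    by (rule exI) (rule derivative_intros n)+
qed auto

lemma gauss_poly_continuous: "gauss_poly f \<Longrightarrow> continuous_on UNIV f"
  by (simp add: continuous_at_imp_continuous_on differentiable_imp_continuous_within gauss_poly_differentiable)

lemma gauss_poly_smooth:
  assumes "gauss_poly f"
  shows "smooth f"
proof -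
  have "C_k k f" for k
    using assms
    by (induction k arbitrary: f)
      (auto simp: gauss_poly_continuous gauss_poly_differentiable gauss_poly_partial_deriv)
  then show ?thesis
    by (simp add: smooth_def)
qed

lemma gauss_poly_bounded:
  assumes "gauss_poly f"
  shows "\<exists>B. \<forall>z. \<bar>f z\<bar> \<le> B"
  using assms
proof induction
  case (monomial l i j)
  obtain B1 where B1: "\<And>x. \<bar>x ^ i * exp (- (l * x\<^sup>2))\<bar> \<le> B1"
    using power_gauss_bounded[OF monomial] by blast
  obtain B2 where B2: "\<And>x. \<bar>x ^ j * exp (- (l * x\<^sup>2))\<bar> \<le> B2"
    using power_gauss_bounded[OF monomial] by blast
  have "\<bar>z $ 1 ^ i * z $ 2 ^ j * gauss l z\<bar> \<le> B1 * B2" for z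
  proof -
    have "\<bar>z $ 1 ^ i * z $ 2 ^ j * gauss l z\<bar>
        = \<bar>z $ 1 ^ i * exp (- (l * (z $ 1)\<^sup>2))\<bar> * \<bar>z $ 2 ^ j * exp (- (l * (z $ 2)\<^sup>2))\<bar>"
      by (simp add: gauss_def abs_mult distrib_left exp_add[symmetric])
    also have "\<dots> \<le> B1 * B2"
      by (intro mult_mono' B1 B2) auto
    finally show ?thesis .
  qed
  then show ?case
    by blast
next
  case (add f g)
  then obtain B1 B2 where "\<And>z. \<bar>f z\<bar> \<le> B1" "\<And>z. \<bar>g z\<bar> \<le> B2"
    by blast
  then have "\<bar>f z + g z\<bar> \<le> B1 + B2" for z
    by (intro order_trans[OF abs_triangle_ineq] add_mono)
  then show ?case
    by blast
next
  case (mult f c)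
  then obtain B where "\<And>z. \<bar>f z\<bar> \<le> B"
    by blast
  then have "\<bar>c * f z\<bar> \<le> \<bar>c\<bar> * B" for z
    by (simp add: abs_mult mult_left_mono)
  then show ?case
    by blast
qed

section \<open>Second-order bounds and strong log-concavity of small perturbations\<close>

definition C2_bounded :: "real \<Rightarrow> (real^2 \<Rightarrow> real) \<Rightarrow> bool" where
  "C2_bounded B f \<longleftrightarrow> (\<forall>z. \<bar>f z\<bar> \<le> B \<and> (\<forall>i. \<bar>partial_deriv i f z\<bar> \<le> B) \<and>
     (\<forall>i j. \<bar>partial_deriv i (partial_deriv j f) z\<bar> \<le> B))"

lemma gauss_poly_C2_bounded:
  assumes "gauss_poly f"
  shows "\<exists>B\<ge>0. C2_bounded B f"
proof -
  obtain B0 where B0: "\<And>z. \<bar>f z\<bar> \<le> B0"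
    using gauss_poly_bounded[OF assms] by blast
  have "\<forall>i. \<exists>B. \<forall>z. \<bar>partial_deriv i f z\<bar> \<le> B"
    using gauss_poly_bounded gauss_poly_partial_deriv(1)[OF assms] by blast
  then obtain B1 where B1: "\<And>i z. \<bar>partial_deriv i f z\<bar> \<le> B1 i"
    by metis
  have "\<forall>i j. \<exists>B. \<forall>z. \<bar>partial_deriv i (partial_deriv j f) z\<bar> \<le> B"
    using gauss_poly_bounded gauss_poly_partial_deriv(1) assms by blast
  then obtain B2 where B2: "\<And>i j z. \<bar>partial_deriv i (partial_deriv j f) z\<bar> \<le> B2 i j"
    by metis
  define B where "B = Max (insert B0 (range B1 \<union> range (\<lambda>(i, j). B2 i j)))"
  have f: "finite (insert B0 (range B1 \<union> range (\<lambda>(i, j). B2 i j)))"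
    by simp
  have "B0 \<le> B" "B1 i \<le> B" "B2 i j \<le> B" for i j
    unfolding B_def by (rule Max_ge[OF f]; force)+
  then have "C2_bounded B f"
    unfolding C2_bounded_def using B0 B1 B2 by (meson order_trans)
  moreover have "0 \<le> B"
    using \<open>B0 \<le> B\<close> B0[of 0] by linarith
  ultimately show ?thesis
    by blast
qed

lemma C2_bounded_combination:
  assumes f: "gauss_poly f" "C2_bounded B f" and g: "gauss_poly g" "C2_bounded B' g"
  shows "C2_bounded (\<bar>c\<bar> * B + \<bar>d\<bar> * B') (\<lambda>z. c * f z + d * g z)"
proof -
  have D: "partial_deriv k (\<lambda>z. c * f z + d * g z) = (\<lambda>z. c * partial_deriv k f z + d * partial_deriv k g z)"
    if "gauss_poly f" "gauss_poly g" for k f g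
    using gauss_poly_partial_deriv(2)[OF that(1), of k] gauss_poly_partial_deriv(2)[OF that(2), of k]
    by (intro ext has_partial_imp_partial_deriv)
      (auto simp: has_partial_def intro!: DERIV_add DERIV_cmult)
  have "\<bar>c * a + d * b\<bar> \<le> \<bar>c\<bar> * B + \<bar>d\<bar> * B'" if "\<bar>a\<bar> \<le> B" "\<bar>b\<bar> \<le> B'" for a b
  proof -
    have "\<bar>c * a + d * b\<bar> \<le> \<bar>c\<bar> * \<bar>a\<bar> + \<bar>d\<bar> * \<bar>b\<bar>"
      by (metis abs_mult abs_triangle_ineq)
    also have "\<dots> \<le> \<bar>c\<bar> * B + \<bar>d\<bar> * B'"
      using that by (intro add_mono mult_left_mono) auto
    finally show ?thesis .
  qed
  then show ?thesis
    using f g by (simp add: C2_bounded_def D gauss_poly_partial_deriv)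
qed

lemma C2_norm_le:
  assumes "C2_bounded B f"
  shows "C2_norm f \<le> ereal B"
proof -
  have fin: "finite {sup_norm (partial_deriv i f) |i. True}"
    "finite {sup_norm (partial_deriv i (partial_deriv j f)) |i j. True}"
  proof -
    have "{sup_norm (partial_deriv i f) |i. True} = range (\<lambda>i. sup_norm (partial_deriv i f))"
      by auto
    then show "finite {sup_norm (partial_deriv i f) |i. True}"
      by simp
    have "{sup_norm (partial_deriv i (partial_deriv j f)) |i j. True}
        = range (\<lambda>(i, j). sup_norm (partial_deriv i (partial_deriv j f)))"
      by auto
    then show "finite {sup_norm (partial_deriv i (partial_deriv j f)) |i j. True}"
      by simp
  qed
  have s: "sup_norm g \<le> ereal B" if "\<And>z. \<bar>g z\<bar> \<le> B" for g
    unfolding sup_norm_def using that by (intro SUP_least) simp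
  show ?thesis
    unfolding C2_norm_def using assms fin
    by (subst Max_le_iff) (auto simp: C2_bounded_def intro!: s)
qed

text \<open>The Hessian of \<open>- ln \<rho>\<close> is the identity minus the Hessian of
  \<open>ln (1 + p)\<close>. The entries of the latter are at most 1/4 in absolute value, so its
  quadratic form is at most half the squared length, which leaves the constant 1/2.\<close>

lemma gauss_perturbation_strongly_log_concave:
  assumes p: "gauss_poly p" "C2_bounded (1/16) p"
    and \<rho>: "\<And>z. \<rho> z = std_gaussian z * (1 + p z)" "smooth \<rho>"
  shows "strongly_log_concave \<rho>"
proof -
  have p1: "\<bar>p z\<bar> \<le> 1/16" "\<bar>partial_deriv i p z\<bar> \<le> 1/16"
    "\<bar>partial_deriv i (partial_deriv j p) z\<bar> \<le> 1/16" for i j z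
    using p(2) unfolding C2_bounded_def by blast+
  have pos1: "0 < 1 + p z" for z
    using p1(1)[of z] by linarith
  have Dp: "((\<lambda>s. p (z + s *\<^sub>R axis i 1)) has_real_derivative partial_deriv i p z) (at 0)" for i z
    using gauss_poly_partial_deriv(2)[OF p(1)] unfolding has_partial_def .
  have DDp: "((\<lambda>s. partial_deriv j p (z + s *\<^sub>R axis i 1)) has_real_derivative
      partial_deriv i (partial_deriv j p) z) (at 0)" for i j z
    using gauss_poly_partial_deriv(2)[OF gauss_poly_partial_deriv(1)[OF p(1)]] unfolding has_partial_def .
  have ln: "- ln (\<rho> z) = ln (2 * pi) + ((z $ 1)\<^sup>2 + (z $ 2)\<^sup>2) / 2 - ln (1 + p z)" for z
  proof -
    have "ln (std_gaussian z) = - ln (2 * pi) - ((z $ 1)\<^sup>2 + (z $ 2)\<^sup>2) / 2"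
      by (simp add: std_gaussian_def ln_mult ln_div add_divide_distrib diff_divide_distrib)
    moreover have "ln (\<rho> z) = ln (std_gaussian z) + ln (1 + p z)"
      unfolding \<rho> using pos1[of z] by (intro ln_mult_pos) (simp_all add: std_gaussian_def)
    ultimately show ?thesis
      by simp
  qed
  have D1: "partial_deriv j (\<lambda>z. - ln (\<rho> z)) = (\<lambda>z. z $ j - partial_deriv j p z / (1 + p z))" for j
    unfolding ln
  proof (intro ext has_partial_imp_partial_deriv)
    fix z :: "real^2"
    have "axis j 1 $ 1 * z $ 1 + axis j 1 $ 2 * z $ 2 = z $ j"
      by (cases j rule: two_cases) (auto simp: axis_def)
    then show "has_partial j (\<lambda>z. ln (2 * pi) + ((z $ 1)\<^sup>2 + (z $ 2)\<^sup>2) / 2 - ln (1 + p z)) z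
        (z $ j - partial_deriv j p z / (1 + p z))"
      unfolding has_partial_def using Dp[of z j] pos1[of z]
      by (auto intro!: derivative_eq_intros)
  qed
  \<comment> \<open>\<open>R\<close> is the Hessian of \<open>ln (1 + p)\<close>.\<close>
  define R where "R i j z = (partial_deriv i (partial_deriv j p) z * (1 + p z)
      - partial_deriv j p z * partial_deriv i p z) / (1 + p z)\<^sup>2" for i j z
  have D2: "partial_deriv i (\<lambda>z. z $ j - partial_deriv j p z / (1 + p z)) z
      = (if i = j then 1 else 0) - R i j z" for i j z
  proof (rule has_partial_imp_partial_deriv)
    have "axis i (1::real) $ j = (if i = j then 1 else 0)"
      by (auto simp: axis_def)
    then show "has_partial i (\<lambda>z. z $ j - partial_deriv j p z / (1 + p z)) z ((if i = j then 1 else 0) - R i j z)"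
      unfolding has_partial_def R_def using Dp[of z i] DDp[of j z i] pos1[of z]
      by (auto intro!: derivative_eq_intros simp: power2_eq_square)
  qed
  have R: "\<bar>R i j z\<bar> \<le> 1/4" for i j z
  proof -
    have "\<bar>partial_deriv i (partial_deriv j p) z * (1 + p z) - partial_deriv j p z * partial_deriv i p z\<bar>
        \<le> \<bar>partial_deriv i (partial_deriv j p) z\<bar> * \<bar>1 + p z\<bar> + \<bar>partial_deriv j p z\<bar> * \<bar>partial_deriv i p z\<bar>"
      by (metis abs_mult abs_triangle_ineq4)
    also have "\<dots> \<le> 1/16 * (17/16) + 1/16 * (1/16)"
      using p1(1)[of z] by (intro add_mono mult_mono p1) auto
    also have "\<dots> \<le> 1/4 * (15/16)\<^sup>2"
      by (simp add: power2_eq_square)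
    also have "\<dots> \<le> 1/4 * (1 + p z)\<^sup>2"
      using p1(1)[of z] by (intro mult_left_mono power_mono) auto
    finally show ?thesis
      using pos1[of z] by (simp add: R_def field_simps)
  qed
  have "pos_semidef (hessian (\<lambda>y. - ln (\<rho> y)) x - mat (1/2))" for x
    unfolding pos_semidef_def
  proof
    fix v :: "real^2"
    let ?a = "v $ 1" and ?b = "v $ 2"
    have H: "(hessian (\<lambda>y. - ln (\<rho> y)) x - mat (1/2)) $ i $ j = (if i = j then 1/2 else 0) - R i j x" for i j
      by (simp add: hessian_def D1 D2 mat_def)
    have "v \<bullet> ((hessian (\<lambda>y. - ln (\<rho> y)) x - mat (1/2)) *v v)
        = 1/2 * (?a\<^sup>2 + ?b\<^sup>2) - (R 1 1 x * (?a * ?a) + R 1 2 x * (?a * ?b) + R 2 1 x * (?a * ?b) + R 2 2 x * (?b * ?b))"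
      by (simp only: inner_real_2 matrix_vector_mult_def vec_lambda_beta sum_2 H)
        (simp add: power2_eq_square algebra_simps)
    \<comment> \<open>Here \<open>A\<close>, \<open>B\<close> and \<open>m\<close> stand for the
      squares of the two coordinates of \<open>v\<close> and for the absolute value of their
      product.\<close>
    moreover have "0 \<le> 1/2 * (A + B) - (a + b + c + d)"
      if "a \<le> 1/4 * A" "b \<le> 1/4 * m" "c \<le> 1/4 * m" "d \<le> 1/4 * B" "m \<le> (A + B) / 2" for A B a b c d m :: real
      using that by simp
    moreover have "\<bar>?a * ?b\<bar> \<le> (?a\<^sup>2 + ?b\<^sup>2) / 2"
      using sum_squares_bound[of "\<bar>?a\<bar>" "\<bar>?b\<bar>"] by (simp add: abs_mult)
    moreover have "R i j x * c \<le> 1/4 * \<bar>c\<bar>" for i j c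
      by (rule order_trans[OF abs_ge_self]) (use mult_right_mono[OF R, of "\<bar>c\<bar>"] in \<open>simp add: abs_mult\<close>)
    moreover have "\<bar>?a * ?a\<bar> = ?a\<^sup>2" "\<bar>?b * ?b\<bar> = ?b\<^sup>2"
      by (simp_all add: power2_eq_square)
    ultimately show "0 \<le> v \<bullet> ((hessian (\<lambda>y. - ln (\<rho> y)) x - mat (1/2)) *v v)"
      by metis
  qed
  moreover have "0 < \<rho> z" for z
    using pos1[of z] by (simp add: \<rho> std_gaussian_def)
  ultimately show ?thesis
    unfolding strongly_log_concave_def using \<rho>(2) by (intro conjI exI[of _ "1/2"]) auto
qed

section \<open>The perturbation argument\<close>

text \<open>Strict monotonicity turns each inequality between values of \<open>Q\<close> into the
  reverse one between arguments, so order neighbourhoods of \<open>Q a\<close> pull back to those of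
  \<open>a\<close>.\<close>

lemma tendsto_if_strict_antimono:
  fixes Q :: "real \<Rightarrow> real"
  assumes Q: "\<And>x y. x < y \<Longrightarrow> Q y < Q x" and lim: "(\<lambda>n. Q (h n)) \<longlonglongrightarrow> Q a"
  shows "h \<longlonglongrightarrow> a"
proof -
  have less: "x < y" if "Q y < Q x" for x y
    using Q[of y x] that by (cases x y rule: linorder_cases) auto
  show ?thesis
  proof (rule order_tendstoI)
    show "\<forall>\<^sub>F n in sequentially. b < h n" if "b < a" for b
      using order_tendstoD(2)[OF lim Q[OF that]] by eventually_elim (rule less)
    show "\<forall>\<^sub>F n in sequentially. h n < b" if "a < b" for b
      using order_tendstoD(1)[OF lim Q[OF that]] by eventually_elim (rule less)
  qed
qed

lemma tendsto_null_mult_bounded: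
  fixes f g :: "nat \<Rightarrow> real"
  assumes "f \<longlonglongrightarrow> 0" "\<And>n. \<bar>g n\<bar> \<le> K"
  shows "(\<lambda>n. f n * g n) \<longlonglongrightarrow> 0"
proof (rule Lim_null_comparison)
  show "\<forall>\<^sub>F n in sequentially. norm (f n * g n) \<le> \<bar>f n\<bar> * K"
    using assms(2) by (simp add: abs_mult mult_left_mono)
  show "(\<lambda>n. \<bar>f n\<bar> * K) \<longlonglongrightarrow> 0"
    using tendsto_mult_right[OF tendsto_rabs[OF assms(1)], of K] by (simp add: mult.commute)
qed

text \<open>Here \<open>c = cos 2\<theta>\<close> and \<open>s = sin 2\<theta>\<close>. The hypothesis on \<open>V\<close> cancels the oscillating part of the second-order
  term: with \<open>x = lim (h - h0) / \<epsilon> = c P(h0) / \<phi>\<close> that term is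
  \<open>c \<beta> x + (c\<^sup>2 - s\<^sup>2) V(h0) = (- 2 c\<^sup>2 + c\<^sup>2 - s\<^sup>2) V(h0) = - V(h0)\<close>.\<close>

lemma no_common_zero:
  fixes Q P R W A B V :: "real \<Rightarrow> real" and h0 \<phi> \<beta> :: real
  assumes Q: "\<And>x y. x < y \<Longrightarrow> Q y < Q x" "(Q has_real_derivative - \<phi>) (at h0)" "\<phi> \<noteq> 0"
    and bdd: "\<And>h. \<bar>P h\<bar> \<le> K" "\<And>h. \<bar>R h\<bar> \<le> K" "\<And>h. \<bar>W h\<bar> \<le> K"
    and cont: "isCont P h0" "isCont R h0" "isCont W h0" "isCont V h0"
    and A: "A h0 = 0" "(A has_real_derivative 0) (at h0)"
    and B: "B h0 = 0" "(B has_real_derivative \<beta>) (at h0)"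
    and R0: "R h0 = 0" and V: "V h0 \<noteq> 0" "\<beta> * P h0 / \<phi> = - 2 * V h0"
  shows "\<exists>\<epsilon>0>0. \<forall>\<epsilon> c s h. 0 < \<epsilon> \<and> \<epsilon> < \<epsilon>0 \<and> c\<^sup>2 + s\<^sup>2 = 1 \<and>
    Q h + \<epsilon> * (c * P h + s * R h) + \<epsilon>\<^sup>2 * (c * s) * W h = Q h0 \<longrightarrow>
    \<epsilon> * (c * B h + s * A h) + \<epsilon>\<^sup>2 * (c\<^sup>2 - s\<^sup>2) * V h \<noteq> 0"
proof (rule ccontr)
  assume contra: "\<not> ?thesis"
  \<comment> \<open>If no threshold works uniformly on the circle, there are counterexamples with
    \<open>\<epsilon>\<close> tending to 0; a limit along them gives the contradiction.\<close>
  define bad where "bad n \<epsilon> c s h \<longleftrightarrow> 0 < \<epsilon> \<and> \<epsilon> < inverse (real (Suc n)) \<and> c\<^sup>2 + s\<^sup>2 = 1 \<and>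
    Q h + \<epsilon> * (c * P h + s * R h) + \<epsilon>\<^sup>2 * (c * s) * W h = Q h0 \<and>
    \<epsilon> * (c * B h + s * A h) + \<epsilon>\<^sup>2 * (c\<^sup>2 - s\<^sup>2) * V h = 0" for n \<epsilon> c s h
  have "\<exists>\<epsilon> c s h. bad n \<epsilon> c s h" for n
  proof -
    have "0 < inverse (real (Suc n))"
      by simp
    then show ?thesis
      using contra unfolding bad_def by blast
  qed
  then obtain e c s h where "\<And>n. bad n (e n) (c n) (s n) (h n)"
    by metis
  then have e: "\<And>n. 0 < e n" "\<And>n. e n < inverse (real (Suc n))" and cs: "\<And>n. (c n)\<^sup>2 + (s n)\<^sup>2 = 1"
    and M: "\<And>n. Q (h n) + e n * (c n * P (h n) + s n * R (h n)) + (e n)\<^sup>2 * (c n * s n) * W (h n) = Q h0"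
    and D: "\<And>n. e n * (c n * B (h n) + s n * A (h n)) + (e n)\<^sup>2 * ((c n)\<^sup>2 - (s n)\<^sup>2) * V (h n) = 0"
    by (simp_all only: bad_def)
  have "e \<longlonglongrightarrow> 0"
    by (rule tendsto_sandwich[OF _ _ tendsto_const LIMSEQ_inverse_real_of_nat])
      (use e in \<open>auto intro!: always_eventually less_imp_le\<close>)
  have cs1: "\<bar>c n\<bar> \<le> 1" "\<bar>s n\<bar> \<le> 1" for n
    using cs[of n] zero_le_power2[of "c n"] zero_le_power2[of "s n"]
    unfolding abs_square_le_1[symmetric] by linarith+
  \<comment> \<open>Compactness supplies a subsequence along which the direction
    \<open>(c, s)\<close> converges.\<close>
  have "compact ({-1..1} \<times> {-1..1} :: (real \<times> real) set)"
    by (intro compact_Times) auto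
  moreover have "(c n, s n) \<in> {-1..1} \<times> {-1..1}" for n
    using cs1[of n] by auto
  ultimately obtain l r where r: "strict_mono (r :: nat \<Rightarrow> nat)" and l: "((\<lambda>n. (c n, s n)) \<circ> r) \<longlonglongrightarrow> l"
    unfolding compact_def by meson
  \<comment> \<open>The displacement of the boundary of the half-plane, rescaled to first order in
    \<epsilon>.\<close>
  define x where "x n = (h (r n) - h0) / e (r n)" for n
  let ?e = "\<lambda>n. e (r n)" and ?c = "\<lambda>n. c (r n)" and ?s = "\<lambda>n. s (r n)" and ?h = "\<lambda>n. h (r n)"
  obtain C S where "l = (C, S)"
    by (cases l)
  then have CS: "?c \<longlonglongrightarrow> C" "?s \<longlonglongrightarrow> S"
    using tendsto_fst[OF l] tendsto_snd[OF l] by (simp_all add: o_def)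
  have e0: "?e \<longlonglongrightarrow> 0"
    using LIMSEQ_subseq_LIMSEQ[OF \<open>e \<longlonglongrightarrow> 0\<close> r] by (simp add: o_def)
  have "(\<lambda>n. (?c n)\<^sup>2 + (?s n)\<^sup>2) \<longlonglongrightarrow> C\<^sup>2 + S\<^sup>2"
    by (intro tendsto_intros CS)
  then have CS1: "C\<^sup>2 + S\<^sup>2 = 1"
    using cs by (simp add: LIMSEQ_const_iff)
  have "\<bar>a * b\<bar> \<le> K" if "\<bar>a\<bar> \<le> 1" "\<bar>b\<bar> \<le> K" for a b :: real
    using mult_mono'[OF that] by (simp add: abs_mult)
  note bd = this
  \<comment> \<open>Nothing is known about \<open>h n\<close> yet. As \<open>P\<close>,
    \<open>R\<close> and \<open>W\<close> are bounded on the whole line, the perturbation of the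
    mass tends to 0 all the same, which forces \<open>h n\<close> towards \<open>h0\<close>.\<close>
  have "(\<lambda>n. ?e n * (?c n * P (?h n)) + ?e n * (?s n * R (?h n)) + ?e n * ?e n * (?c n * (?s n * W (?h n)))) \<longlonglongrightarrow> 0 + 0 + 0"
    by (rule tendsto_add[OF tendsto_add[OF tendsto_null_mult_bounded[OF e0] tendsto_null_mult_bounded[OF e0]]
          tendsto_null_mult_bounded[OF tendsto_mult_zero[OF e0 e0]]])
      (rule bd cs1 bdd)+
  moreover have "Q h0 - Q (?h n) = ?e n * (?c n * P (?h n)) + ?e n * (?s n * R (?h n)) + ?e n * ?e n * (?c n * (?s n * W (?h n)))" for n
    using M[of "r n"] by (simp add: algebra_simps power2_eq_square)
  ultimately have "(\<lambda>n. Q h0 - Q (?h n)) \<longlonglongrightarrow> 0"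
    by simp
  then have "(\<lambda>n. Q h0 - (Q h0 - Q (?h n))) \<longlonglongrightarrow> Q h0 - 0"
    by (intro tendsto_intros)
  then have h: "?h \<longlonglongrightarrow> h0"
    by (simp add: tendsto_if_strict_antimono[OF Q(1)])
  \<comment> \<open>Caratheodory's slope functions avoid division by \<open>h n - h0\<close>, which
    may be zero.\<close>
  obtain gQ where gQ: "\<And>z. Q z - Q h0 = gQ z * (z - h0)" "isCont gQ h0" "gQ h0 = - \<phi>"
    using CARAT_DERIV[THEN iffD1, OF Q(2)] by auto
  obtain gA where gA: "\<And>z. A z - A h0 = gA z * (z - h0)" "isCont gA h0" "gA h0 = 0"
    using CARAT_DERIV[THEN iffD1, OF A(2)] by auto
  obtain gB where gB: "\<And>z. B z - B h0 = gB z * (z - h0)" "isCont gB h0" "gB h0 = \<beta>"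
    using CARAT_DERIV[THEN iffD1, OF B(2)] by auto
  have hx: "?h n - h0 = ?e n * x n" for n
    using e(1)[of "r n"] by (simp add: x_def)
  \<comment> \<open>The mass equation divided by \<epsilon> determines the limit of
    \<open>x n\<close>.\<close>
  have gQx: "gQ (?h n) * x n = - (?c n * P (?h n) + ?s n * R (?h n)) - ?e n * (?c n * ?s n) * W (?h n)" for n
  proof -
    have "?e n * (gQ (?h n) * x n) = ?e n * (- (?c n * P (?h n) + ?s n * R (?h n)) - ?e n * (?c n * ?s n) * W (?h n))"
      using M[of "r n"] gQ(1)[of "?h n"] by (simp add: hx algebra_simps power2_eq_square)
    then show ?thesis
      using e(1)[of "r n"] by simp
  qed
  have limQ: "(\<lambda>n. gQ (?h n)) \<longlonglongrightarrow> - \<phi>"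
    using isCont_tendsto_compose[OF gQ(2) h] gQ(3) by simp
  have "(\<lambda>n. (- (?c n * P (?h n) + ?s n * R (?h n)) - ?e n * (?c n * ?s n) * W (?h n)) / gQ (?h n))
      \<longlonglongrightarrow> (- (C * P h0 + S * R h0) - 0 * (C * S) * W h0) / (- \<phi>)"
    by (intro tendsto_intros CS e0 limQ isCont_tendsto_compose[OF cont(1) h]
        isCont_tendsto_compose[OF cont(2) h] isCont_tendsto_compose[OF cont(3) h]) (use Q(3) in simp)
  moreover have "\<forall>\<^sub>F n in sequentially. gQ (?h n) \<noteq> 0"
    using tendsto_imp_eventually_ne[OF limQ] Q(3) by simp
  then have "\<forall>\<^sub>F n in sequentially.
    (- (?c n * P (?h n) + ?s n * R (?h n)) - ?e n * (?c n * ?s n) * W (?h n)) / gQ (?h n) = x n"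
    by eventually_elim (subst gQx[symmetric], simp)
  ultimately have "x \<longlonglongrightarrow> (- (C * P h0 + S * R h0) - 0 * (C * S) * W h0) / (- \<phi>)"
    by (rule Lim_transform_eventually)
  then have x: "x \<longlonglongrightarrow> C * P h0 / \<phi>"
    using R0 by simp
  \<comment> \<open>Since \<open>A\<close> and \<open>B\<close> vanish at \<open>h0\<close>, the
    difference equation is of order \<open>\<epsilon>^2\<close>; dividing by that factor leaves a
    nontrivial limit.\<close>
  have "?c n * (gB (?h n) * x n) + ?s n * (gA (?h n) * x n) + ((?c n)\<^sup>2 - (?s n)\<^sup>2) * V (?h n) = 0" for n
  proof -
    have "(?e n)\<^sup>2 * (?c n * (gB (?h n) * x n) + ?s n * (gA (?h n) * x n) + ((?c n)\<^sup>2 - (?s n)\<^sup>2) * V (?h n)) = 0"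
    proof -
      have "A (?h n) = gA (?h n) * (?e n * x n)" "B (?h n) = gB (?h n) * (?e n * x n)"
        using gA(1)[of "?h n"] gB(1)[of "?h n"] A(1) B(1) unfolding hx by simp_all
      then show ?thesis
        using D[of "r n"] by (simp add: algebra_simps power2_eq_square)
    qed
    then show ?thesis
      using e(1)[of "r n"] by simp
  qed
  moreover have "(\<lambda>n. ?c n * (gB (?h n) * x n) + ?s n * (gA (?h n) * x n) + ((?c n)\<^sup>2 - (?s n)\<^sup>2) * V (?h n))
      \<longlonglongrightarrow> C * (gB h0 * (C * P h0 / \<phi>)) + S * (gA h0 * (C * P h0 / \<phi>)) + (C\<^sup>2 - S\<^sup>2) * V h0"
    by (intro tendsto_intros CS x isCont_tendsto_compose[OF gA(2) h]
        isCont_tendsto_compose[OF gB(2) h] isCont_tendsto_compose[OF cont(4) h])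
  ultimately have "C * (\<beta> * (C * P h0 / \<phi>)) + (C\<^sup>2 - S\<^sup>2) * V h0 = 0"
    using gA(3) gB(3) by (simp add: LIMSEQ_const_iff)
  moreover have "C * (\<beta> * (C * P h0 / \<phi>)) = C\<^sup>2 * (- 2 * V h0)"
    unfolding V(2)[symmetric] by (simp add: power2_eq_square)
  ultimately have "(C\<^sup>2 + S\<^sup>2) * V h0 = 0"
    by (simp add: algebra_simps)
  then show False
    using CS1 V(1) by simp
qed

section \<open>Sector integrals of the perturbing terms\<close>

text \<open>For \<open>z = x + i y\<close> the polynomial factor is
  \<open>a Re z^2 + b Im z^2\<close>, and that of \<open>quart\<close> is \<open>Im z^4\<close>.
  Such harmonic polynomials keep their form under rotation; only the coefficients turn.\<close>

definition quad :: "real \<Rightarrow> real \<Rightarrow> real \<Rightarrow> real^2 \<Rightarrow> real" where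
  "quad a b l z = (a * ((z $ 1)\<^sup>2 - (z $ 2)\<^sup>2) + b * (2 * z $ 1 * z $ 2)) * gauss l z"

definition quart :: "real \<Rightarrow> real^2 \<Rightarrow> real" where
  "quart l z = (4 * (z $ 1) ^ 3 * z $ 2 - 4 * z $ 1 * (z $ 2) ^ 3) * gauss l z"

lemma gauss_poly_quad:
  assumes "0 < l"
  shows "gauss_poly (quad a b l)"
proof -
  have "quad a b l = (\<lambda>z. a * (z $ 1 ^ 2 * z $ 2 ^ 0 * gauss l z - z $ 1 ^ 0 * z $ 2 ^ 2 * gauss l z)
      + 2 * b * (z $ 1 ^ 1 * z $ 2 ^ 1 * gauss l z))"
    by (simp add: quad_def fun_eq_iff algebra_simps)
  then show ?thesis
    by (simp only:) (intro gauss_poly.add gauss_poly.mult gauss_poly_diff gauss_poly.monomial assms)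
qed

lemma gauss_poly_quart:
  assumes "0 < l"
  shows "gauss_poly (quart l)"
proof -
  have "quart l = (\<lambda>z. 4 * (z $ 1 ^ 3 * z $ 2 ^ 1 * gauss l z) - 4 * (z $ 1 ^ 1 * z $ 2 ^ 3 * gauss l z))"
    by (simp add: quart_def fun_eq_iff algebra_simps)
  then show ?thesis
    by (simp only:) (intro gauss_poly.mult gauss_poly_diff gauss_poly.monomial assms)
qed

lemma std_gaussian_eq: "std_gaussian = (\<lambda>z. 1 / (2 * pi) * gauss (1/2) z)"
proof
  fix z :: "real^2"
  have "- a / 2 = - (1/2 * a)" for a :: real
    by simp
  then show "std_gaussian z = 1 / (2 * pi) * gauss (1/2) z"
    unfolding std_gaussian_def gauss_def by metis
qed

lemma gauss_poly_std_gaussian: "gauss_poly std_gaussian"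
  unfolding std_gaussian_eq by (intro gauss_poly.mult gauss_poly_gauss) simp

lemma gauss_minus [simp]: "gauss l (- z) = gauss l z"
  by (simp add: gauss_def)

lemma quad_minus [simp]: "quad a b l (- z) = quad a b l z"
  by (simp add: quad_def)

lemma quart_minus [simp]: "quart l (- z) = quart l z"
  by (simp add: quart_def)

lemma std_gaussian_minus [simp]: "std_gaussian (- z) = std_gaussian z"
  by (simp add: std_gaussian_def)

text \<open>The sign \<open>\<sigma> = \<plusminus>1\<close> selects one of the two sectors on the same side of the line in direction \<open>u\<close>.\<close>

definition has_frame_integral ::
  "real^2 \<Rightarrow> real \<Rightarrow> real set \<Rightarrow> real set \<Rightarrow> (real^2 \<Rightarrow> real) \<Rightarrow> real \<Rightarrow> bool" where
  "has_frame_integral u \<sigma> A B f I \<longleftrightarrow> has_bochner_integral lborel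
     (\<lambda>p. indicator (A \<times> B) p *\<^sub>R f (fst p *\<^sub>R (\<sigma> *\<^sub>R u) + snd p *\<^sub>R perp u)) I"

lemma has_frame_integral_add:
  "has_frame_integral u \<sigma> A B f I \<Longrightarrow> has_frame_integral u \<sigma> A B g J \<Longrightarrow>
    has_frame_integral u \<sigma> A B (\<lambda>z. f z + g z) (I + J)"
  unfolding has_frame_integral_def scaleR_add_right by (rule has_bochner_integral_add)

lemma has_frame_integral_mult:
  "has_frame_integral u \<sigma> A B f I \<Longrightarrow> has_frame_integral u \<sigma> A B (\<lambda>z. c * f z) (c * I)"
  unfolding has_frame_integral_def
  using has_bochner_integral_mult_right[of c lborel "\<lambda>p. indicat_real (A \<times> B) p *\<^sub>R f (fst p *\<^sub>R (\<sigma> *\<^sub>R u) + snd p *\<^sub>R perp u)" I]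
  by (simp add: mult.left_commute)

abbreviation moment :: "nat \<Rightarrow> real \<Rightarrow> real set \<Rightarrow> real" where
  "moment j l A \<equiv> LINT x:A|lborel. x ^ j * exp (- (l * x\<^sup>2))"

lemma has_bochner_integral_power_gauss_product:
  assumes "0 < l" "A \<in> sets borel" "B \<in> sets borel"
  shows "has_bochner_integral lborel (\<lambda>p. indicator (A \<times> B) p *\<^sub>R
      (fst p ^ i * snd p ^ j * exp (- (l * ((fst p)\<^sup>2 + (snd p)\<^sup>2))))) (moment i l A * moment j l B)"
  using power_gauss_product[OF assms, of i j]
  by (simp add: has_bochner_integral_iff set_integrable_def set_lebesgue_integral_def)

lemma has_frame_integral_I:
  assumes "has_bochner_integral lborel (\<lambda>p. indicator (A \<times> B) p *\<^sub>R g (fst p) (snd p)) I"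
    and "\<And>x y. f (x *\<^sub>R (\<sigma> *\<^sub>R u) + y *\<^sub>R perp u) = g x y"
  shows "has_frame_integral u \<sigma> A B f I"
  using assms by (simp add: has_frame_integral_def)

section \<open>Sector integrals in a rotated frame\<close>

context
  fixes u :: "real^2" and \<sigma> c s :: real
  assumes u: "norm u = 1" and \<sigma>: "\<sigma>\<^sup>2 = 1"
    and c: "c = (u $ 1)\<^sup>2 - (u $ 2)\<^sup>2" and s: "s = 2 * u $ 1 * u $ 2"
begin

lemma u_sq: "(u $ 1)\<^sup>2 + (u $ 2)\<^sup>2 = 1"
  using u by (simp add: norm_real_2)

lemma norm_frame: "(\<sigma> * x * u $ 1 - y * u $ 2)\<^sup>2 + (\<sigma> * x * u $ 2 + y * u $ 1)\<^sup>2 = x\<^sup>2 + y\<^sup>2"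
  using u_sq \<sigma> by algebra

lemma gauss_frame: "gauss l (x *\<^sub>R (\<sigma> *\<^sub>R u) + y *\<^sub>R perp u) = exp (- (l * (x\<^sup>2 + y\<^sup>2)))"
  unfolding gauss_def by (simp add: norm_frame[of x y, symmetric] mult_ac)

text \<open>In complex notation the point is \<open>u (\<sigma> x + i y)\<close> and
  \<open>u^2 = c + i s\<close>, hence \<open>z^2 = (c + i s) (x^2 - y^2 + 2 i \<sigma> x y)\<close>.
  If \<open>u\<close> has angle \<open>\<theta>\<close>, then \<open>c = cos 2\<theta>\<close> and
  \<open>s = sin 2\<theta>\<close>.\<close>

lemma quad_frame:
  "quad a b l (x *\<^sub>R (\<sigma> *\<^sub>R u) + y *\<^sub>R perp u)
    = ((a * c + b * s) * (x\<^sup>2 - y\<^sup>2) + \<sigma> * (b * c - a * s) * (2 * x * y)) * exp (- (l * (x\<^sup>2 + y\<^sup>2)))"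
proof -
  have "a * ((\<sigma> * x * u $ 1 - y * u $ 2)\<^sup>2 - (\<sigma> * x * u $ 2 + y * u $ 1)\<^sup>2)
      + b * (2 * (\<sigma> * x * u $ 1 - y * u $ 2) * (\<sigma> * x * u $ 2 + y * u $ 1))
    = (a * c + b * s) * (x\<^sup>2 - y\<^sup>2) + \<sigma> * (b * c - a * s) * (2 * x * y)"
    using \<sigma> unfolding c s by algebra
  then show ?thesis
    unfolding quad_def gauss_frame by (simp add: mult_ac)
qed

text \<open>The imaginary part of \<open>z^4 = (c + i s)^2 (\<sigma> x + i y)^4\<close>, where
  \<open>\<sigma>^2 = 1\<close>.\<close>

lemma quart_frame:
  "quart l (x *\<^sub>R (\<sigma> *\<^sub>R u) + y *\<^sub>R perp u)
    = (2 * c * s * (x ^ 4 - 6 * x\<^sup>2 * y\<^sup>2 + y ^ 4) + \<sigma> * (c\<^sup>2 - s\<^sup>2) * (4 * x ^ 3 * y - 4 * x * y ^ 3))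
      * exp (- (l * (x\<^sup>2 + y\<^sup>2)))"
proof -
  have "4 * (\<sigma> * x * u $ 1 - y * u $ 2) ^ 3 * (\<sigma> * x * u $ 2 + y * u $ 1)
      - 4 * (\<sigma> * x * u $ 1 - y * u $ 2) * (\<sigma> * x * u $ 2 + y * u $ 1) ^ 3
    = 2 * c * s * (x ^ 4 - 6 * x\<^sup>2 * y\<^sup>2 + y ^ 4) + \<sigma> * (c\<^sup>2 - s\<^sup>2) * (4 * x ^ 3 * y - 4 * x * y ^ 3)"
    using \<sigma> unfolding c s by algebra
  then show ?thesis
    unfolding quart_def gauss_frame by (simp add: mult_ac)
qed

lemma frame_integral_std_gaussian:
  assumes "A \<in> sets borel" "B \<in> sets borel"
  shows "has_frame_integral u \<sigma> A B std_gaussian (1 / (2 * pi) * (moment 0 (1/2) A * moment 0 (1/2) B))"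
proof (rule has_frame_integral_I)
  show "has_bochner_integral lborel (\<lambda>p. indicator (A \<times> B) p *\<^sub>R
      (1 / (2 * pi) * (fst p ^ 0 * snd p ^ 0 * exp (- (1/2 * ((fst p)\<^sup>2 + (snd p)\<^sup>2))))))
      (1 / (2 * pi) * (moment 0 (1/2) A * moment 0 (1/2) B))"
    using has_bochner_integral_mult_right[OF has_bochner_integral_power_gauss_product[OF _ assms, of "1/2" 0 0], of "1 / (2 * pi)"]
    by (simp add: mult_ac)
  show "std_gaussian (x *\<^sub>R (\<sigma> *\<^sub>R u) + y *\<^sub>R perp u)
      = 1 / (2 * pi) * (x ^ 0 * y ^ 0 * exp (- (1/2 * (x\<^sup>2 + y\<^sup>2))))" for x y
    by (simp only: std_gaussian_eq gauss_frame power_0 mult_1)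
qed

lemma frame_integral_quad:
  assumes "0 < l" "A \<in> sets borel" "B \<in> sets borel"
  shows "has_frame_integral u \<sigma> A B (quad a b l)
    ((a * c + b * s) * (moment 2 l A * moment 0 l B - moment 0 l A * moment 2 l B)
      + \<sigma> * (b * c - a * s) * (2 * (moment 1 l A * moment 1 l B)))"
proof (rule has_frame_integral_I)
  let ?e = "\<lambda>i j p. indicator (A \<times> B) p *\<^sub>R (fst p ^ i * snd p ^ j * exp (- (l * ((fst p)\<^sup>2 + (snd p)\<^sup>2))))"
  note e = has_bochner_integral_power_gauss_product[OF assms]
  have "has_bochner_integral lborel (\<lambda>p. (a * c + b * s) * (?e 2 0 p - ?e 0 2 p) + \<sigma> * (b * c - a * s) * (2 * ?e 1 1 p))
    ((a * c + b * s) * (moment 2 l A * moment 0 l B - moment 0 l A * moment 2 l B)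
      + \<sigma> * (b * c - a * s) * (2 * (moment 1 l A * moment 1 l B)))"
    by (intro has_bochner_integral_add has_bochner_integral_diff has_bochner_integral_mult_right e)
  also have "(\<lambda>p. (a * c + b * s) * (?e 2 0 p - ?e 0 2 p) + \<sigma> * (b * c - a * s) * (2 * ?e 1 1 p))
    = (\<lambda>p. indicator (A \<times> B) p *\<^sub>R (((a * c + b * s) * ((fst p)\<^sup>2 - (snd p)\<^sup>2) + \<sigma> * (b * c - a * s) * (2 * fst p * snd p))
        * exp (- (l * ((fst p)\<^sup>2 + (snd p)\<^sup>2)))))"
    by (rule ext) (simp add: indicator_def algebra_simps)
  finally show "has_bochner_integral lborel \<dots>
    ((a * c + b * s) * (moment 2 l A * moment 0 l B - moment 0 l A * moment 2 l B)
      + \<sigma> * (b * c - a * s) * (2 * (moment 1 l A * moment 1 l B)))" .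
qed (rule quad_frame)

lemma frame_integral_quart:
  assumes "0 < l" "A \<in> sets borel" "B \<in> sets borel"
  shows "has_frame_integral u \<sigma> A B (quart l)
    (2 * c * s * (moment 4 l A * moment 0 l B - 6 * (moment 2 l A * moment 2 l B) + moment 0 l A * moment 4 l B)
      + \<sigma> * (c\<^sup>2 - s\<^sup>2) * (4 * (moment 3 l A * moment 1 l B) - 4 * (moment 1 l A * moment 3 l B)))"
proof (rule has_frame_integral_I)
  let ?e = "\<lambda>i j p. indicator (A \<times> B) p *\<^sub>R (fst p ^ i * snd p ^ j * exp (- (l * ((fst p)\<^sup>2 + (snd p)\<^sup>2))))"
  note e = has_bochner_integral_power_gauss_product[OF assms]
  have "has_bochner_integral lborel (\<lambda>p. 2 * c * s * (?e 4 0 p - 6 * ?e 2 2 p + ?e 0 4 p)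
      + \<sigma> * (c\<^sup>2 - s\<^sup>2) * (4 * ?e 3 1 p - 4 * ?e 1 3 p))
    (2 * c * s * (moment 4 l A * moment 0 l B - 6 * (moment 2 l A * moment 2 l B) + moment 0 l A * moment 4 l B)
      + \<sigma> * (c\<^sup>2 - s\<^sup>2) * (4 * (moment 3 l A * moment 1 l B) - 4 * (moment 1 l A * moment 3 l B)))"
    by (intro has_bochner_integral_add has_bochner_integral_diff has_bochner_integral_mult_right e)
  also have "(\<lambda>p. 2 * c * s * (?e 4 0 p - 6 * ?e 2 2 p + ?e 0 4 p)
      + \<sigma> * (c\<^sup>2 - s\<^sup>2) * (4 * ?e 3 1 p - 4 * ?e 1 3 p))
    = (\<lambda>p. indicator (A \<times> B) p *\<^sub>R ((2 * c * s * ((fst p) ^ 4 - 6 * (fst p)\<^sup>2 * (snd p)\<^sup>2 + (snd p) ^ 4)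
        + \<sigma> * (c\<^sup>2 - s\<^sup>2) * (4 * (fst p) ^ 3 * snd p - 4 * fst p * (snd p) ^ 3))
        * exp (- (l * ((fst p)\<^sup>2 + (snd p)\<^sup>2)))))"
    by (rule ext) (simp add: indicator_def algebra_simps)
  finally show "has_bochner_integral lborel \<dots>
    (2 * c * s * (moment 4 l A * moment 0 l B - 6 * (moment 2 l A * moment 2 l B) + moment 0 l A * moment 4 l B)
      + \<sigma> * (c\<^sup>2 - s\<^sup>2) * (4 * (moment 3 l A * moment 1 l B) - 4 * (moment 1 l A * moment 3 l B)))" .
qed (rule quart_frame)

lemma sector_integral_std_gaussian:
  "has_frame_integral u \<sigma> {0<..} {h<..} std_gaussian (1/2 * (tail_moment 0 (1/2) h / sqrt (2 * pi)))"
proof -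
  have "1 / (2 * pi) * (tail_moment 0 (1/2) 0 * t) = 1/2 * (t / sqrt (2 * pi))" for t
  proof -
    have T: "tail_moment 0 (1/2) 0 = sqrt (2 * pi) / 2"
      by (simp add: tail_moment_0_at_0 mult.commute)
    have "1 / r\<^sup>2 * (r / 2 * t) = 1/2 * (t / r)" if "r \<noteq> 0" for r :: real
      using that by (simp add: power2_eq_square)
    from this[of "sqrt (2 * pi)"] show ?thesis
      unfolding T by simp
  qed
  then show ?thesis
    using frame_integral_std_gaussian[of "{0<..}" "{h<..}"] by (simp only: tail_moment_def[symmetric] borel_open[OF open_greaterThan] zero_less_one)
qed

text \<open>By the recursion for moments the terms with \<open>tail_moment 0 l h\<close> cancel, and
  only elementary functions of \<open>h\<close> remain.\<close>

lemma sector_integral_quad: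
  assumes "0 < l"
  shows "has_frame_integral u \<sigma> {0<..} {h<..} (quad a b l)
    (1/2 * (- (a * c + b * s) * sqrt (pi / l) * h / (2 * l) * exp (- (l * h\<^sup>2))
      + \<sigma> * (b * c - a * s) / l\<^sup>2 * exp (- (l * h\<^sup>2))))"
proof -
  have T: "tail_moment 2 l h = h * exp (- (l * h\<^sup>2)) / (2 * l) + tail_moment 0 l h / (2 * l)" for h
    using tail_moment_Suc_Suc[OF assms, of 0 h] by (simp add: numeral_2_eq_2)
  have "tail_moment 2 l 0 * tail_moment 0 l h - tail_moment 0 l 0 * tail_moment 2 l h
      = - tail_moment 0 l 0 * h / (2 * l) * exp (- (l * h\<^sup>2))"
    unfolding T using assms by (simp add: algebra_simps)
  then have eq1: "tail_moment 2 l 0 * tail_moment 0 l h - tail_moment 0 l 0 * tail_moment 2 l h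
      = - sqrt (pi / l) * h / (4 * l) * exp (- (l * h\<^sup>2))"
    by (simp add: tail_moment_0_at_0[OF assms])
  have eq2: "2 * (tail_moment 1 l 0 * tail_moment 1 l h) = exp (- (l * h\<^sup>2)) / (2 * l\<^sup>2)"
    using assms by (simp only: tail_moment_1) (simp add: power2_eq_square)
  have "(a * c + b * s) * (tail_moment 2 l 0 * tail_moment 0 l h - tail_moment 0 l 0 * tail_moment 2 l h)
      + \<sigma> * (b * c - a * s) * (2 * (tail_moment 1 l 0 * tail_moment 1 l h))
    = 1/2 * (- (a * c + b * s) * sqrt (pi / l) * h / (2 * l) * exp (- (l * h\<^sup>2))
      + \<sigma> * (b * c - a * s) / l\<^sup>2 * exp (- (l * h\<^sup>2)))"
    unfolding eq1 eq2 using assms by (simp add: field_simps)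
  then show ?thesis
    using frame_integral_quad[OF assms, of "{0<..}" "{h<..}" a b] by (simp only: tail_moment_def[symmetric] borel_open[OF open_greaterThan] zero_less_one)
qed

text \<open>The zeroth tail moment cancels again: its coefficients 3/4, - 3/2 and 3/4 sum to
  0.\<close>

lemma sector_integral_quart:
  "has_frame_integral u \<sigma> {0<..} {h<..} (quart 1)
    (1/2 * (c * s * (2 * sqrt pi * (h ^ 3 / 2 - 3 * h / 4) * exp (- h\<^sup>2))
      - \<sigma> * (c\<^sup>2 - s\<^sup>2) * (2 * h\<^sup>2 * exp (- h\<^sup>2))))"
proof -
  let ?T = "\<lambda>j. tail_moment j 1"
  have T: "?T 1 h = exp (- h\<^sup>2) / 2" "?T 2 h = h * exp (- h\<^sup>2) / 2 + 1/2 * ?T 0 h"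
    "?T 3 h = h\<^sup>2 * exp (- h\<^sup>2) / 2 + ?T 1 h" "?T 4 h = h ^ 3 * exp (- h\<^sup>2) / 2 + 3/2 * ?T 2 h" for h
    using tail_moment_1[of 1 h] tail_moment_Suc_Suc[of 1 0 h] tail_moment_Suc_Suc[of 1 1 h] tail_moment_Suc_Suc[of 1 2 h]
    by (simp_all add: numeral_eq_Suc)
  have eq1: "?T 4 0 * ?T 0 h - 6 * (?T 2 0 * ?T 2 h) + ?T 0 0 * ?T 4 h
      = ?T 0 0 * (h ^ 3 / 2 - 3 * h / 4) * exp (- h\<^sup>2)"
    unfolding T by (simp add: algebra_simps)
  have eq2: "?T 0 0 = sqrt pi / 2"
    by (simp add: tail_moment_0_at_0)
  have eq3: "4 * (?T 3 0 * ?T 1 h) - 4 * (?T 1 0 * ?T 3 h) = - h\<^sup>2 * exp (- h\<^sup>2)"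
    unfolding T by (simp add: algebra_simps)
  have "2 * c * s * (?T 4 0 * ?T 0 h - 6 * (?T 2 0 * ?T 2 h) + ?T 0 0 * ?T 4 h)
      + \<sigma> * (c\<^sup>2 - s\<^sup>2) * (4 * (?T 3 0 * ?T 1 h) - 4 * (?T 1 0 * ?T 3 h))
    = 1/2 * (c * s * (2 * sqrt pi * (h ^ 3 / 2 - 3 * h / 4) * exp (- h\<^sup>2))
      - \<sigma> * (c\<^sup>2 - s\<^sup>2) * (2 * h\<^sup>2 * exp (- h\<^sup>2)))"
    unfolding eq1 eq3 unfolding eq2 by (simp add: algebra_simps)
  then show ?thesis
    using frame_integral_quart[of 1 "{0<..}" "{h<..}"] by (simp only: tail_moment_def[symmetric] borel_open[OF open_greaterThan] zero_less_one)
qed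

end

section \<open>The perturbed density\<close>

lemma measure_density_frame_sector:
  assumes u: "norm u = 1" and \<sigma>: "\<sigma>\<^sup>2 = 1"
    and f: "f \<in> borel_measurable borel" "\<And>z. 0 \<le> f z"
    and I: "has_frame_integral u \<sigma> {0<..} {h<..} f I"
  shows "measure (density_measure f) {z. 0 < z \<bullet> (\<sigma> *\<^sub>R u) \<and> h < z \<bullet> perp u} = I"
proof -
  have "\<bar>\<sigma>\<bar> = 1"
    using \<sigma> by (auto simp: power2_eq_1_iff)
  then have "measure (density_measure f) {z. 0 < z \<bullet> (\<sigma> *\<^sub>R u) \<and> h < z \<bullet> perp u}
      = (LINT p:{0<..} \<times> {h<..}|lborel. f (fst p *\<^sub>R (\<sigma> *\<^sub>R u) + snd p *\<^sub>R perp u))"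
    using u I orthogonal_perp[of u] f
    by (intro measure_density_sector)
      (auto simp: orthogonal_clauses has_frame_integral_def has_bochner_integral_iff set_integrable_def)
  also have "\<dots> = I"
    using I by (simp add: has_frame_integral_def has_bochner_integral_iff set_lebesgue_integral_def)
  finally show ?thesis .
qed

section \<open>Integrals over the whole plane: the perturbation has total mass zero\<close>

lemma has_bochner_integral_plane:
  assumes "norm u = 1" and f: "f \<in> borel_measurable borel"
    and I: "has_frame_integral u 1 UNIV UNIV f I"
  shows "has_bochner_integral lborel f I"
proof -
  have "has_bochner_integral lborel (\<lambda>p. f (fst p *\<^sub>R u + snd p *\<^sub>R perp u)) I"
    using I by (simp add: has_frame_integral_def)
  then have "has_bochner_integral (distr lborel borel (\<lambda>p. fst p *\<^sub>R u + snd p *\<^sub>R perp u)) f I"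
    using f by (intro has_bochner_integral_distr) (auto intro!: borel_measurable_continuous_onI continuous_intros)
  then show ?thesis
    using assms(1) by (simp add: distr_lborel_orthonormal orthogonal_perp)
qed

lemma moment_1_UNIV: "moment 1 l UNIV = 0"
proof -
  let ?f = "\<lambda>x. x * exp (- (l * x\<^sup>2)) :: real"
  have "(\<integral>x. ?f x \<partial>lborel) = (\<integral>x. ?f x \<partial>distr lborel borel uminus)"
    by (simp add: lborel_distr_uminus)
  also have "\<dots> = (\<integral>x. ?f (- x) \<partial>lborel)"
    by (rule integral_distr) auto
  also have "\<dots> = - (\<integral>x. ?f x \<partial>lborel)"
    by simp
  finally show ?thesis
    by (simp add: set_lebesgue_integral_def)
qed

lemma moment_0_UNIV: "moment 0 (1/2) UNIV = sqrt (2 * pi)"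
proof -
  have "(\<integral>x. std_normal_density x \<partial>lborel) = 1"
    by simp
  then have "(\<integral>x. exp (- x\<^sup>2 / 2) \<partial>lborel) = sqrt (2 * pi)"
    unfolding std_normal_density_def by (simp add: field_simps)
  then show ?thesis
    by (simp add: set_lebesgue_integral_def)
qed

lemma plane_integral_std_gaussian: "has_bochner_integral lborel std_gaussian 1"
proof -
  have u: "norm (axis 1 1 :: real^2) = 1" "(1::real)\<^sup>2 = 1"
    by auto
  show ?thesis
    using has_bochner_integral_plane[OF u(1) _ frame_integral_std_gaussian[OF u refl refl, of UNIV UNIV]]
    by (simp add: moment_0_UNIV[simplified] gauss_poly_continuous gauss_poly_std_gaussian borel_measurable_continuous_onI)
qed

lemma plane_integral_quad:
  assumes "0 < l"
  shows "has_bochner_integral lborel (quad a b l) 0"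
proof -
  have u: "norm (axis 1 1 :: real^2) = 1" "(1::real)\<^sup>2 = 1"
    by auto
  have "quad a b l \<in> borel_measurable borel"
    by (intro borel_measurable_continuous_onI gauss_poly_continuous gauss_poly_quad assms)
  from has_bochner_integral_plane[OF u(1) this frame_integral_quad[OF u refl refl assms, of UNIV UNIV]]
  show ?thesis
    by (simp add: moment_1_UNIV[simplified] axis_def)
qed

text \<open>In the frame of the first axis \<open>s = 0\<close>, which removes the even bracket; the
  odd one vanishes with the first moments.\<close>

lemma plane_integral_quart:
  assumes "0 < l"
  shows "has_bochner_integral lborel (quart l) 0"
proof -
  have u: "norm (axis 1 1 :: real^2) = 1" "(1::real)\<^sup>2 = 1"
    by auto
  have "quart l \<in> borel_measurable borel"
    by (intro borel_measurable_continuous_onI gauss_poly_continuous gauss_poly_quart assms)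
  from has_bochner_integral_plane[OF u(1) this frame_integral_quart[OF u refl refl assms, of UNIV UNIV]]
  show ?thesis
    by (simp add: moment_1_UNIV[simplified] axis_def)
qed

lemma gauss_quad_shift: "gauss k z * quad a b l z = quad a b (k + l) z"
  by (simp add: quad_def gauss_mult[symmetric] mult_ac)

lemma gauss_quart_shift: "gauss k z * quart l z = quart (k + l) z"
  by (simp add: quart_def gauss_mult[symmetric] mult_ac)

section \<open>Gaussian mass of half-planes and the distance \<open>h0\<close>\<close>

definition normal_tail :: "real \<Rightarrow> real" where
  "normal_tail h = tail_moment 0 (1/2) h / sqrt (2 * pi)"

lemma normal_tail_deriv: "(normal_tail has_real_derivative - (exp (- (h\<^sup>2 / 2)) / sqrt (2 * pi))) (at h)"
  unfolding normal_tail_def using DERIV_cdivide[OF tail_moment_0_deriv[of "1/2" h], of "sqrt (2 * pi)"] by simp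

lemma normal_tail_less: "x < y \<Longrightarrow> normal_tail y < normal_tail x"
  by (rule DERIV_neg_imp_decreasing) (use normal_tail_deriv in \<open>auto intro!: exI\<close>)

text \<open>Intermediate value theorem between 0, where the tail is 1/2, and infinity, where it
  tends to 0.\<close>

lemma normal_tail_surj:
  assumes "0 < m" "m < 1/2"
  shows "\<exists>h>0. normal_tail h = m"
proof -
  have n0: "normal_tail 0 = 1/2"
    by (simp add: normal_tail_def tail_moment_0_at_0 mult.commute)
  have "(normal_tail \<longlongrightarrow> 0 / sqrt (2 * pi)) at_top"
    unfolding normal_tail_def by (intro tendsto_intros tail_moment_0_tendsto) auto
  then have "\<forall>\<^sub>F h in at_top. normal_tail h < m"
    using assms(1) by (intro order_tendstoD(2)) auto
  then obtain b where b: "0 < b" "normal_tail b < m"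
    using eventually_happens'[OF _ eventually_conj[OF _ eventually_gt_at_top[of 0]]]
      trivial_limit_at_top_linorder by metis
  have "\<exists>h. 0 \<le> h \<and> h \<le> b \<and> normal_tail h = m"
    using b n0 assms(2) normal_tail_deriv by (intro IVT2) (auto intro: DERIV_isCont)
  then show ?thesis
    using n0 assms(2) by (metis order.not_eq_order_implies_strict order_less_irrefl)
qed

section \<open>The explicit perturbation and its sector integrals\<close>

context
  fixes h0 :: real
begin

text \<open>With this amplitude the factor \<open>exp (- (l * h^2))\<close> of the sector integrals
  becomes \<open>l^2 * rel l h\<close>, where \<open>rel l\<close> is normalised to 1 at
  \<open>h0\<close>; see \<open>amp_exp\<close>.\<close>

definition amp :: "real \<Rightarrow> real" where
  "amp l = l\<^sup>2 * exp (l * h0\<^sup>2)"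

definition rel :: "real \<Rightarrow> real \<Rightarrow> real" where
  "rel l h = exp (- (l * (h\<^sup>2 - h0\<^sup>2)))"

text \<open>This is \<open>sqrt pi\<close> divided by the standard normal density at
  \<open>h0\<close>, the value for which the oscillating second-order terms cancel.\<close>

definition corrector_scale :: real where
  "corrector_scale = sqrt pi * sqrt (2 * pi) * exp (h0\<^sup>2 / 2)"

text \<open>The coefficients \<open>(5, - 8, 3)\<close> are orthogonal to \<open>(1, 1, 1)\<close> and \<open>(1, 4, 9)\<close>, and \<open>(1, - 2, 1)\<close> to
  \<open>(1, 1, 1)\<close> and \<open>(1, 2, 3)\<close>: with the normalisation \<open>amp\<close>, the three vectors are the values at \<open>h0\<close>
  of the mass difference, of its \<open>h\<close>-derivative and of the half-plane mass, up to factors independent of \<open>l\<close>.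
  The shift \<open>d = 1/2\<close> divides by the Gaussian \<open>exp (- |z|\<^sup>2 / 2)\<close>.\<close>

definition spiral :: "real \<Rightarrow> real^2 \<Rightarrow> real" where
  "spiral d z = quad (5 * amp 1) (1 * amp 1) (1 - d) z
     + (quad (- 8 * amp 4) (- 2 * amp 4) (4 - d) z + quad (3 * amp 9) (1 * amp 9) (9 - d) z)"

text \<open>The minus sign offsets the negative mass difference of \<open>quart 1\<close> and makes
  \<open>skew_cs\<close> positive at \<open>h0\<close> when \<open>0 < h0\<close>.\<close>

definition corrector :: "real \<Rightarrow> real^2 \<Rightarrow> real" where
  "corrector d z = (- corrector_scale * amp 1) * quart (1 - d) z"

definition perturbed :: "real \<Rightarrow> real^2 \<Rightarrow> real" where
  "perturbed \<epsilon> z = std_gaussian z + (\<epsilon> * spiral 0 z + \<epsilon>\<^sup>2 * corrector 0 z)"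

text \<open>The \<open>tail\<close> functions are the coefficients in the mass of the half-plane,
  the \<open>skew\<close> functions those in the difference of its two halves. The suffixes refer to
  the angular factors \<open>c\<close>, \<open>s\<close> and, at second order, \<open>c * s\<close>
  or \<open>c^2 - s^2\<close>. In \<open>tail_c\<close> and \<open>tail_s\<close> the coefficients
  of the spiral are multiplied by \<open>sqrt l\<close>, that is by 1, 2, 3.\<close>

definition tail_c :: "real \<Rightarrow> real" where
  "tail_c h = - sqrt pi / 2 * (5 * (h * rel 1 h) - 16 * (h * rel 4 h) + 9 * (h * rel 9 h))"

definition tail_s :: "real \<Rightarrow> real" where
  "tail_s h = - sqrt pi / 2 * (1 * (h * rel 1 h) - 4 * (h * rel 4 h) + 3 * (h * rel 9 h))"

definition tail_cs :: "real \<Rightarrow> real" where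
  "tail_cs h = - 2 * corrector_scale * sqrt pi * (1/2 * (h ^ 3 * rel 1 h) - 3/4 * (h * rel 1 h))"

definition skew_c :: "real \<Rightarrow> real" where
  "skew_c h = rel 1 h - 2 * rel 4 h + rel 9 h"

definition skew_s :: "real \<Rightarrow> real" where
  "skew_s h = - (5 * rel 1 h - 8 * rel 4 h + 3 * rel 9 h)"

definition skew_cs :: "real \<Rightarrow> real" where
  "skew_cs h = 2 * corrector_scale * (h\<^sup>2 * rel 1 h)"

lemma gauss_poly_spiral: "d < 1 \<Longrightarrow> gauss_poly (spiral d)"
  unfolding spiral_def by (intro gauss_poly.add gauss_poly_quad) auto

lemma gauss_poly_corrector: "d < 1 \<Longrightarrow> gauss_poly (corrector d)"
  unfolding corrector_def by (intro gauss_poly.mult gauss_poly_quart) auto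

lemma gauss_poly_perturbed: "gauss_poly (perturbed \<epsilon>)"
  unfolding perturbed_def
  by (intro gauss_poly.add gauss_poly.mult gauss_poly_std_gaussian gauss_poly_spiral gauss_poly_corrector) auto

lemma perturbed_minus: "perturbed \<epsilon> (- z) = perturbed \<epsilon> z"
  by (simp add: perturbed_def spiral_def corrector_def)

text \<open>Division by the Gaussian lowers the rates to \<open>l - 1/2\<close>, which stay
  positive, so the relative perturbation is again bounded together with its derivatives. The factor
  \<open>2 * pi\<close> inverts the normalising constant.\<close>

lemma perturbed_eq:
  "perturbed \<epsilon> z = std_gaussian z * (1 + (2 * pi * \<epsilon> * spiral (1/2) z + 2 * pi * \<epsilon>\<^sup>2 * corrector (1/2) z))"
proof -
  have "gauss (1/2) z * spiral (1/2) z = spiral 0 z" "gauss (1/2) z * corrector (1/2) z = corrector 0 z"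
    by (simp_all add: spiral_def corrector_def distrib_left gauss_quad_shift gauss_quart_shift mult.left_commute)
  then show ?thesis
    unfolding perturbed_def std_gaussian_eq by (simp add: algebra_simps)
qed

lemma plane_integral_perturbed: "has_bochner_integral lborel (perturbed \<epsilon>) 1"
proof -
  have "has_bochner_integral lborel (perturbed \<epsilon>) (1 + (\<epsilon> * (0 + (0 + 0)) + \<epsilon>\<^sup>2 * ((- corrector_scale * amp 1) * 0)))"
    unfolding perturbed_def spiral_def corrector_def
    by (intro has_bochner_integral_add has_bochner_integral_mult_right
        plane_integral_std_gaussian plane_integral_quad plane_integral_quart) auto
  then show ?thesis
    by simp
qed

lemma amp_exp: "amp l * exp (- (l * h\<^sup>2)) = l\<^sup>2 * rel l h"
  by (simp add: amp_def rel_def exp_add[symmetric] algebra_simps)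

lemma sector_integral_amp_quad:
  assumes u: "norm u = 1" "\<sigma>\<^sup>2 = 1" "c = (u $ 1)\<^sup>2 - (u $ 2)\<^sup>2" "s = 2 * u $ 1 * u $ 2"
    and r: "0 < r" "l = r\<^sup>2"
  shows "has_frame_integral u \<sigma> {0<..} {h<..} (quad (\<alpha> * amp l) (\<beta> * amp l) (l - 0))
    (1/2 * (- (\<alpha> * c + \<beta> * s) * sqrt pi * r / 2 * (h * rel l h) + \<sigma> * (\<beta> * c - \<alpha> * s) * rel l h))"
proof -
  have l: "0 < l" "sqrt (pi / l) = sqrt pi / r"
    using r by (simp_all add: real_sqrt_divide)
  have "- (\<alpha> * amp l * c + \<beta> * amp l * s) * sqrt (pi / l) * h / (2 * l) * exp (- (l * h\<^sup>2))
      = - (\<alpha> * c + \<beta> * s) * (sqrt pi / r) * h / (2 * l) * (amp l * exp (- (l * h\<^sup>2)))"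
    unfolding l by (simp add: algebra_simps)
  also have "\<dots> = - (\<alpha> * c + \<beta> * s) * sqrt pi * r / 2 * (h * rel l h)"
    unfolding amp_exp using r by (simp add: power2_eq_square)
  finally have eq1: "- (\<alpha> * amp l * c + \<beta> * amp l * s) * sqrt (pi / l) * h / (2 * l) * exp (- (l * h\<^sup>2))
      = - (\<alpha> * c + \<beta> * s) * sqrt pi * r / 2 * (h * rel l h)" .
  have "\<sigma> * (\<beta> * amp l * c - \<alpha> * amp l * s) / l\<^sup>2 * exp (- (l * h\<^sup>2))
      = \<sigma> * (\<beta> * c - \<alpha> * s) / l\<^sup>2 * (amp l * exp (- (l * h\<^sup>2)))"
    by (simp add: algebra_simps)
  also have "\<dots> = \<sigma> * (\<beta> * c - \<alpha> * s) * rel l h"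
    unfolding amp_exp using l by simp
  finally have eq2: "\<sigma> * (\<beta> * amp l * c - \<alpha> * amp l * s) / l\<^sup>2 * exp (- (l * h\<^sup>2))
      = \<sigma> * (\<beta> * c - \<alpha> * s) * rel l h" .
  show ?thesis
    using sector_integral_quad[OF u l(1), of h "\<alpha> * amp l" "\<beta> * amp l"] unfolding eq1 eq2 by simp
qed

lemma sector_integral_corrector:
  assumes u: "norm u = 1" "\<sigma>\<^sup>2 = 1" "c = (u $ 1)\<^sup>2 - (u $ 2)\<^sup>2" "s = 2 * u $ 1 * u $ 2"
  shows "has_frame_integral u \<sigma> {0<..} {h<..} (corrector 0)
    (1/2 * (c * s * tail_cs h + \<sigma> * (c\<^sup>2 - s\<^sup>2) * skew_cs h))"
proof -
  have "(- corrector_scale * amp 1) * (1/2 * (c * s * (2 * sqrt pi * (h ^ 3 / 2 - 3 * h / 4) * exp (- h\<^sup>2))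
      - \<sigma> * (c\<^sup>2 - s\<^sup>2) * (2 * h\<^sup>2 * exp (- h\<^sup>2))))
    = 1/2 * (c * s * (- 2 * corrector_scale * sqrt pi * (h ^ 3 / 2 - 3 * h / 4) * (amp 1 * exp (- (1 * h\<^sup>2))))
      + \<sigma> * (c\<^sup>2 - s\<^sup>2) * (2 * corrector_scale * h\<^sup>2 * (amp 1 * exp (- (1 * h\<^sup>2)))))"
    by (simp add: algebra_simps)
  also have "\<dots> = 1/2 * (c * s * tail_cs h + \<sigma> * (c\<^sup>2 - s\<^sup>2) * skew_cs h)"
    unfolding amp_exp tail_cs_def skew_cs_def by (simp add: algebra_simps)
  finally show ?thesis
    using has_frame_integral_mult[OF sector_integral_quart[OF u], of h "- corrector_scale * amp 1"]
    unfolding corrector_def by simp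
qed

text \<open>The two signs of \<sigma> give the two halves of the half-plane. Hence the part free of
  \<sigma> is half of its mass, and the coefficient of \<sigma> is half of the mass
  difference.\<close>

lemma sector_integral_perturbed:
  assumes u: "norm u = 1" "\<sigma>\<^sup>2 = 1" "c = (u $ 1)\<^sup>2 - (u $ 2)\<^sup>2" "s = 2 * u $ 1 * u $ 2"
  shows "has_frame_integral u \<sigma> {0<..} {h<..} (perturbed \<epsilon>)
    (1/2 * ((normal_tail h + \<epsilon> * (c * tail_c h + s * tail_s h) + \<epsilon>\<^sup>2 * (c * s) * tail_cs h)
      + \<sigma> * (\<epsilon> * (c * skew_c h + s * skew_s h) + \<epsilon>\<^sup>2 * (c\<^sup>2 - s\<^sup>2) * skew_cs h)))"
proof -
  note std = sector_integral_std_gaussian[OF u, folded normal_tail_def]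
  let ?q = "\<lambda>\<alpha> \<beta> r l. 1/2 * (- (\<alpha> * c + \<beta> * s) * sqrt pi * r / 2 * (h * rel l h) + \<sigma> * (\<beta> * c - \<alpha> * s) * rel l h)"
  have "has_frame_integral u \<sigma> {0<..} {h<..} (perturbed \<epsilon>)
    (1/2 * normal_tail h + (\<epsilon> * (?q 5 1 1 1 + (?q (- 8) (- 2) 2 4 + ?q 3 1 3 9))
      + \<epsilon>\<^sup>2 * (1/2 * (c * s * tail_cs h + \<sigma> * (c\<^sup>2 - s\<^sup>2) * skew_cs h))))"
    unfolding perturbed_def spiral_def
    by (intro has_frame_integral_add has_frame_integral_mult std
        sector_integral_amp_quad[OF u] sector_integral_corrector[OF u]) auto
  also have "1/2 * normal_tail h + (\<epsilon> * (?q 5 1 1 1 + (?q (- 8) (- 2) 2 4 + ?q 3 1 3 9))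
      + \<epsilon>\<^sup>2 * (1/2 * (c * s * tail_cs h + \<sigma> * (c\<^sup>2 - s\<^sup>2) * skew_cs h)))
    = 1/2 * ((normal_tail h + \<epsilon> * (c * tail_c h + s * tail_s h) + \<epsilon>\<^sup>2 * (c * s) * tail_cs h)
      + \<sigma> * (\<epsilon> * (c * skew_c h + s * skew_s h) + \<epsilon>\<^sup>2 * (c\<^sup>2 - s\<^sup>2) * skew_cs h))"
    unfolding tail_c_def tail_s_def skew_c_def skew_s_def by (simp add: field_simps)
  finally show ?thesis .
qed

section \<open>Expansion at \<open>h0\<close> and exclusion of cuts for small \<epsilon>\<close>

lemma rel_at_h0: "rel l h0 = 1"
  by (simp add: rel_def)

lemma rel_deriv: "(rel l has_real_derivative - 2 * l * h0) (at h0)"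
  unfolding rel_def by (auto intro!: derivative_eq_intros)

lemma isCont_rel: "isCont (rel l) h"
  unfolding rel_def by (intro continuous_intros)

lemma bounded_power_rel:
  assumes "0 < l"
  shows "bounded (range (\<lambda>h. h ^ j * rel l h))"
proof -
  obtain K where K: "\<And>h. \<bar>h ^ j * exp (- (l * h\<^sup>2))\<bar> \<le> K"
    using power_gauss_bounded[OF assms] by blast
  have "h ^ j * rel l h = exp (l * h0\<^sup>2) * (h ^ j * exp (- (l * h\<^sup>2)))" for h
    by (simp add: rel_def exp_add[symmetric] algebra_simps)
  then have "norm (h ^ j * rel l h) = exp (l * h0\<^sup>2) * \<bar>h ^ j * exp (- (l * h\<^sup>2))\<bar>" for h
    by (simp only: real_norm_def abs_mult abs_exp_cancel)
  then have "norm (h ^ j * rel l h) \<le> exp (l * h0\<^sup>2) * K" for h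
    using mult_left_mono[OF K[of h], of "exp (l * h0\<^sup>2)"] by simp
  then show ?thesis
    by (auto simp: bounded_iff)
qed

lemma bounded_tails: "\<exists>K. \<forall>h. \<bar>tail_c h\<bar> \<le> K \<and> \<bar>tail_s h\<bar> \<le> K \<and> \<bar>tail_cs h\<bar> \<le> K"
proof -
  have mult: "bounded (range (\<lambda>h. c * f h))" if "bounded (range f)" for c and f :: "real \<Rightarrow> real"
    using bounded_scaleR_comp[OF that, of c] by simp
  have 1: "bounded (range (\<lambda>h. h * rel l h))" if "0 < l" for l
    using bounded_power_rel[OF that, of 1] by simp
  have "bounded (range tail_c)" "bounded (range tail_s)" "bounded (range tail_cs)"
    unfolding tail_c_def tail_s_def tail_cs_def
    by (intro mult bounded_plus_comp bounded_minus_comp 1 bounded_power_rel; simp)+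
  then obtain K1 K2 K3 where "\<And>h. \<bar>tail_c h\<bar> \<le> K1" "\<And>h. \<bar>tail_s h\<bar> \<le> K2" "\<And>h. \<bar>tail_cs h\<bar> \<le> K3"
    by (auto simp: bounded_iff)
  then show ?thesis
    by (intro exI[of _ "max K1 (max K2 K3)"]) (auto simp: le_max_iff_disj)
qed

lemma skew_nonzero:
  assumes "0 < h0"
  shows "\<exists>\<epsilon>0>0. \<forall>\<epsilon> c s h. 0 < \<epsilon> \<and> \<epsilon> < \<epsilon>0 \<and> c\<^sup>2 + s\<^sup>2 = 1 \<and>
    normal_tail h + \<epsilon> * (c * tail_c h + s * tail_s h) + \<epsilon>\<^sup>2 * (c * s) * tail_cs h = normal_tail h0 \<longrightarrow>
    \<epsilon> * (c * skew_c h + s * skew_s h) + \<epsilon>\<^sup>2 * (c\<^sup>2 - s\<^sup>2) * skew_cs h \<noteq> 0"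
proof -
  obtain K where K: "\<And>h. \<bar>tail_c h\<bar> \<le> K" "\<And>h. \<bar>tail_s h\<bar> \<le> K" "\<And>h. \<bar>tail_cs h\<bar> \<le> K"
    using bounded_tails by blast
  let ?\<phi> = "exp (- (h0\<^sup>2 / 2)) / sqrt (2 * pi)"
  have "corrector_scale = sqrt pi / ?\<phi>"
    by (simp add: corrector_scale_def exp_minus field_simps)
  \<comment> \<open>Since \<open>5 - 16 + 9 = - 2\<close>, the value \<open>tail_c h0\<close> is
    \<open>sqrt pi * h0\<close>; the slope \<open>- 4 * h0\<close> of \<open>skew_c\<close> is
    \<open>- 2 * h0 * (1 - 8 + 9)\<close>.\<close>
  then have V: "- 4 * h0 * tail_c h0 / ?\<phi> = - 2 * skew_cs h0"
    by (simp add: tail_c_def skew_cs_def rel_at_h0 power2_eq_square)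
  show ?thesis
  proof (rule no_common_zero[where Q=normal_tail and P=tail_c and R=tail_s and W=tail_cs and
        A=skew_s and B=skew_c and V=skew_cs and K=K and \<phi>="?\<phi>" and \<beta>="- 4 * h0"])
    show "\<bar>tail_c h\<bar> \<le> K" "\<bar>tail_s h\<bar> \<le> K" "\<bar>tail_cs h\<bar> \<le> K" for h
      by (rule K)+
    show "normal_tail y < normal_tail x" if "x < y" for x y
      by (rule normal_tail_less[OF that])
    show "(normal_tail has_real_derivative - ?\<phi>) (at h0)"
      by (rule normal_tail_deriv)
    show "- 4 * h0 * tail_c h0 / ?\<phi> = - 2 * skew_cs h0"
      by (rule V)
    show "isCont tail_c h0" "isCont tail_s h0" "isCont tail_cs h0" "isCont skew_cs h0"
      unfolding tail_c_def tail_s_def tail_cs_def skew_cs_def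
      by (intro continuous_intros isCont_rel; simp)+
    show "(skew_s has_real_derivative 0) (at h0)"
      unfolding skew_s_def by (auto intro!: derivative_eq_intros rel_deriv)
    show "(skew_c has_real_derivative - 4 * h0) (at h0)"
      unfolding skew_c_def by (auto intro!: derivative_eq_intros rel_deriv)
  qed (use assms in \<open>auto simp: skew_c_def skew_s_def tail_s_def skew_cs_def rel_at_h0 corrector_scale_def\<close>)
qed

lemma uncuttable_perturbed:
  assumes "0 < h0" "normal_tail h0 = 2 * t"
  shows "\<exists>\<epsilon>0>0. \<forall>\<epsilon>. 0 < \<epsilon> \<and> \<epsilon> < \<epsilon>0 \<longrightarrow> uncuttable_density t (perturbed \<epsilon>)"
proof -
  obtain \<epsilon>1 where \<epsilon>1: "0 < \<epsilon>1" "\<And>\<epsilon> c s h. \<lbrakk>0 < \<epsilon>; \<epsilon> < \<epsilon>1; c\<^sup>2 + s\<^sup>2 = 1;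
    normal_tail h + \<epsilon> * (c * tail_c h + s * tail_s h) + \<epsilon>\<^sup>2 * (c * s) * tail_cs h = normal_tail h0\<rbrakk> \<Longrightarrow>
    \<epsilon> * (c * skew_c h + s * skew_s h) + \<epsilon>\<^sup>2 * (c\<^sup>2 - s\<^sup>2) * skew_cs h \<noteq> 0"
    using skew_nonzero[OF assms(1)] by blast
  have gp: "gauss_poly (spiral (1/2))" "gauss_poly (corrector (1/2))"
    by (intro gauss_poly_spiral gauss_poly_corrector; simp)+
  obtain B1 where B1: "0 \<le> B1" "C2_bounded B1 (spiral (1/2))"
    using gauss_poly_C2_bounded[OF gp(1)] by blast
  obtain B2 where B2: "0 \<le> B2" "C2_bounded B2 (corrector (1/2))"
    using gauss_poly_C2_bounded[OF gp(2)] by blast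
  have "uncuttable_density t (perturbed \<epsilon>)"
    \<comment> \<open>The threshold \<open>\<epsilon>1\<close> excludes cuts,
      \<open>\<epsilon> \<le> 1\<close> lets \<open>\<epsilon>\<close> dominate its square, and the
      last bound ensures strong log-concavity.\<close>
    if \<epsilon>: "0 < \<epsilon>" "\<epsilon> < \<epsilon>1" "\<epsilon> \<le> 1" "\<epsilon> * (2 * pi * (B1 + B2)) \<le> 1/16" for \<epsilon>
  proof -
    let ?p = "\<lambda>z. 2 * pi * \<epsilon> * spiral (1/2) z + 2 * pi * \<epsilon>\<^sup>2 * corrector (1/2) z"
    have "gauss_poly ?p"
      by (intro gauss_poly.add gauss_poly.mult gp)
    have "\<epsilon>\<^sup>2 \<le> \<epsilon>"
      using \<epsilon> by (simp add: power2_eq_square mult_left_le)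
    then have "\<bar>2 * pi * \<epsilon>\<bar> * B1 + \<bar>2 * pi * \<epsilon>\<^sup>2\<bar> * B2 \<le> 2 * pi * \<epsilon> * B1 + 2 * pi * \<epsilon> * B2"
      using \<epsilon> B1 B2 by (intro add_mono mult_right_mono) (auto simp: abs_mult)
    also have "\<dots> \<le> 1/16"
      using \<epsilon>(4) by (simp add: algebra_simps)
    finally have p: "C2_bounded (1/16) ?p"
      using C2_bounded_combination[OF gp(1) B1(2) gp(2) B2(2), of "2 * pi * \<epsilon>" "2 * pi * \<epsilon>\<^sup>2"]
      unfolding C2_bounded_def by (meson order_trans)
    have smooth: "smooth (perturbed \<epsilon>)"
      by (rule gauss_poly_smooth[OF gauss_poly_perturbed])
    have slc: "strongly_log_concave (perturbed \<epsilon>)"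
      by (rule gauss_perturbation_strongly_log_concave[OF \<open>gauss_poly ?p\<close> p perturbed_eq smooth])
    then have pos: "0 < perturbed \<epsilon> z" for z
      by (simp add: strongly_log_concave_def)
    have cont: "continuous_on UNIV (perturbed \<epsilon>)"
      by (rule gauss_poly_continuous[OF gauss_poly_perturbed])
    have meas [measurable]: "perturbed \<epsilon> \<in> borel_measurable borel"
      by (rule borel_measurable_continuous_onI[OF cont])
    have prob: "prob_space (density_measure (perturbed \<epsilon>))"
    proof
      have "emeasure (density_measure (perturbed \<epsilon>)) UNIV = (\<integral>\<^sup>+z. ennreal (perturbed \<epsilon> z) \<partial>lborel)"
        unfolding density_measure_def by (subst emeasure_density) auto
      also have "\<dots> = ennreal 1"
        using plane_integral_perturbed[of \<epsilon>] pos
        by (subst nn_integral_eq_integral) (auto simp: has_bochner_integral_iff less_imp_le)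
      finally show "emeasure (density_measure (perturbed \<epsilon>)) (space (density_measure (perturbed \<epsilon>))) = 1"
        by (simp add: density_measure_def)
    qed
    interpret symmetric_density "perturbed \<epsilon>"
      by (intro symmetric_density.intro cont pos perturbed_minus prob)
    have "\<not> perpendicular_cut_masses (density_measure (perturbed \<epsilon>)) t t (1/2 - t) (1/2 - t)"
    proof
      assume "perpendicular_cut_masses (density_measure (perturbed \<epsilon>)) t t (1/2 - t) (1/2 - t)"
      then obtain u h where u: "norm u = 1"
        and m: "prob {z. 0 < z \<bullet> u \<and> h < z \<bullet> perp u} = t" "prob {z. 0 < z \<bullet> (- u) \<and> h < z \<bullet> perp u} = t"
        using cut_through_origin by blast
      define c s where "c = (u $ 1)\<^sup>2 - (u $ 2)\<^sup>2" and "s = 2 * u $ 1 * u $ 2"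
      have "(u $ 1)\<^sup>2 + (u $ 2)\<^sup>2 = 1"
        using u by (simp add: norm_real_2)
      then have cs: "c\<^sup>2 + s\<^sup>2 = 1"
        unfolding c_def s_def by algebra
      let ?M = "normal_tail h + \<epsilon> * (c * tail_c h + s * tail_s h) + \<epsilon>\<^sup>2 * (c * s) * tail_cs h"
      let ?D = "\<epsilon> * (c * skew_c h + s * skew_s h) + \<epsilon>\<^sup>2 * (c\<^sup>2 - s\<^sup>2) * skew_cs h"
      have "prob {z. 0 < z \<bullet> (\<sigma> *\<^sub>R u) \<and> h < z \<bullet> perp u} = 1/2 * (?M + \<sigma> * ?D)" if "\<sigma>\<^sup>2 = 1" for \<sigma>
        by (intro measure_density_frame_sector[OF u that meas] less_imp_le[OF pos]
            sector_integral_perturbed[OF u that c_def s_def])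
      \<comment> \<open>Adding the two equations gives the half-plane mass \<open>2 * t\<close>, and
        subtracting them gives a vanishing difference.\<close>
      from this[of 1] this[of "-1"] have "1/2 * (?M + ?D) = t" "1/2 * (?M - ?D) = t"
        using m by simp_all
      then have "?M = normal_tail h0" "?D = 0"
        unfolding assms(2) by argo+
      then show False
        using \<epsilon>1(2)[OF \<epsilon>(1,2) cs] by blast
    qed
    then show ?thesis
      unfolding uncuttable_density_def probability_density_def centrally_symmetric_def
      using smooth slc pos prob meas perturbed_minus by (auto simp: less_imp_le)
  qed
  note * = this
  \<comment> \<open>The summand 1 keeps the denominator positive even when
    \<open>B1 + B2 = 0\<close>.\<close>
  define \<epsilon>0 where "\<epsilon>0 = min \<epsilon>1 (min 1 (1 / (16 * (2 * pi * (B1 + B2) + 1))))"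
  have n: "0 < 2 * pi * (B1 + B2) + 1"
    using B1(1) B2(1) by (simp add: add_nonneg_pos)
  show ?thesis
  proof (intro exI[of _ \<epsilon>0] conjI allI impI)
    show "0 < \<epsilon>0"
      using \<epsilon>1(1) n by (simp add: \<epsilon>0_def)
    fix \<epsilon> assume \<epsilon>: "0 < \<epsilon> \<and> \<epsilon> < \<epsilon>0"
    then have "\<epsilon> < 1 / (16 * (2 * pi * (B1 + B2) + 1))"
      by (simp add: \<epsilon>0_def)
    then have "\<epsilon> * (2 * pi * (B1 + B2) + 1) < 1/16"
      using n by (simp add: field_simps)
    then have "\<epsilon> * (2 * pi * (B1 + B2)) \<le> 1/16"
      using \<epsilon> by (simp add: algebra_simps)
    then show "uncuttable_density t (perturbed \<epsilon>)"
      using \<epsilon> by (intro *) (auto simp: \<epsilon>0_def)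
  qed
qed

lemma perturbed_C2_close:
  assumes "0 < \<delta>"
  shows "\<exists>\<epsilon>0>0. \<forall>\<epsilon>. 0 < \<epsilon> \<and> \<epsilon> < \<epsilon>0 \<longrightarrow> C2_norm (\<lambda>z. perturbed \<epsilon> z - std_gaussian z) < ereal \<delta>"
proof -
  have gp: "gauss_poly (spiral 0)" "gauss_poly (corrector 0)"
    by (intro gauss_poly_spiral gauss_poly_corrector; simp)+
  obtain B1 where B1: "0 \<le> B1" "C2_bounded B1 (spiral 0)"
    using gauss_poly_C2_bounded[OF gp(1)] by blast
  obtain B2 where B2: "0 \<le> B2" "C2_bounded B2 (corrector 0)"
    using gauss_poly_C2_bounded[OF gp(2)] by blast
  show ?thesis
  proof (intro exI[of _ "min 1 (\<delta> / (B1 + B2 + 1))"] conjI allI impI)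
    show "0 < min 1 (\<delta> / (B1 + B2 + 1))"
      using assms B1(1) B2(1) by simp
    fix \<epsilon> assume \<epsilon>: "0 < \<epsilon> \<and> \<epsilon> < min 1 (\<delta> / (B1 + B2 + 1))"
    have "C2_norm (\<lambda>z. perturbed \<epsilon> z - std_gaussian z) \<le> ereal (\<bar>\<epsilon>\<bar> * B1 + \<bar>\<epsilon>\<^sup>2\<bar> * B2)"
      unfolding perturbed_def add_diff_cancel_left'
      by (intro C2_norm_le C2_bounded_combination gp B1 B2)
    also have "\<bar>\<epsilon>\<bar> * B1 + \<bar>\<epsilon>\<^sup>2\<bar> * B2 \<le> \<epsilon> * B1 + \<epsilon> * B2"
      using \<epsilon> B1 B2 by (intro add_mono mult_right_mono) (auto simp: power2_eq_square mult_left_le)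
    also have "\<dots> < \<epsilon> * (B1 + B2 + 1)"
      using \<epsilon> by (simp add: algebra_simps)
    also have "\<dots> \<le> \<delta>"
      using \<epsilon> B1(1) B2(1) by (simp add: pos_less_divide_eq)
    finally show "C2_norm (\<lambda>z. perturbed \<epsilon> z - std_gaussian z) < ereal \<delta>"
      by simp
  qed
qed

end

section \<open>Existence and closeness to the Gaussian\<close>

theorem theorem1p4:
  fixes t :: real
  assumes "0 < t" and "t < 1/4"
  shows "(\<exists>\<rho>. uncuttable_density t \<rho>) \<and>
         (\<forall>\<delta>::real. \<delta> > 0 \<longrightarrow>
            (\<exists>\<rho>. uncuttable_density t \<rho> \<and> C2_norm (\<lambda>x. \<rho> x - std_gaussian x) < ereal \<delta>))"
proof -
  \<comment> \<open>The bound \<open>t < 1/4\<close> makes \<open>2 * t\<close> smaller than 1/2, so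
    that \<open>h0\<close> is positive.\<close>
  obtain h0 where h0: "0 < h0" "normal_tail h0 = 2 * t"
    using normal_tail_surj[of "2 * t"] assms by auto
  have *: "\<exists>\<rho>. uncuttable_density t \<rho> \<and> C2_norm (\<lambda>x. \<rho> x - std_gaussian x) < ereal \<delta>" if \<delta>: "0 < \<delta>" for \<delta>
  proof -
    obtain \<epsilon>1 where \<epsilon>1: "0 < \<epsilon>1" "\<And>\<epsilon>. 0 < \<epsilon> \<Longrightarrow> \<epsilon> < \<epsilon>1 \<Longrightarrow> uncuttable_density t (perturbed h0 \<epsilon>)"
      using uncuttable_perturbed[OF h0] by blast
    obtain \<epsilon>2 where \<epsilon>2: "0 < \<epsilon>2"
      "\<And>\<epsilon>. 0 < \<epsilon> \<Longrightarrow> \<epsilon> < \<epsilon>2 \<Longrightarrow> C2_norm (\<lambda>z. perturbed h0 \<epsilon> z - std_gaussian z) < ereal \<delta>"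
      using perturbed_C2_close[OF \<delta>] by blast
    obtain \<epsilon> where "0 < \<epsilon>" "\<epsilon> < min \<epsilon>1 \<epsilon>2"
      using dense[of 0 "min \<epsilon>1 \<epsilon>2"] \<epsilon>1(1) \<epsilon>2(1) by auto
    then show ?thesis
      using \<epsilon>1(2) \<epsilon>2(2) by auto
  qed
  then show ?thesis
    \<comment> \<open>Plain existence is the case \<open>\<delta> = 1\<close> of the approximation
      statement.\<close>
    using zero_less_one by blast
qed

end
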